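(* Let $G$ be a $CD1$-group. Then $Z(G)\le N$ and either $$Z(G)=1,\quad |b^G|\ge 2,\quad -b_k\le \frac{a_k}{2}\quad\text{and}\quad g=a_k^2\left(\frac{1+|b^G|}{|b^G|}\right)\le\frac32 a_k^2,$$ or $$|Z(G)|=2,\quad Z(G)=\{1,b\},\quad |b^G|=1,\quad p=2,\quad n=1,\quad b_k=-a_k\quad\text{and}\quad g=2a_k^2 .$$
   Context: All groups are finite. Let $\mathrm{Irr}(G)=\{\chi_1,\dots,\chi_k\}$ be the set of complex irreducible characters of $G$, with $\chi_1=1_G$ and $\chi_1(1)=1\le\chi_2(1)\le\dots\le\chi_k(1)$. A group $G$ is a $CD1$-group if $|G|>2$ and two columns of its character table differ by exactly one entry, i.e. there are non-conjugate $a,b\in G$ and an index $j$ with $\chi_j(a)\ne\chi_j(b)$ and $\chi_i(a)=\chi_i(b)$ for all $i\ne j$. For a $CD1$-group it is known that one of the two conjugacy classes is $\{1\}$, that the other one, denoted $b^G$, is uniquely determined, and that the two columns differ exactly in the row of $\chi_k$. Put $a_k=\chi_k(1)$, $b_k=\chi_k(b)$, $g=|G|$ and $N=\bigcap_{i=1}^{k-1}\ker\chi_i$; it is known that $N=\{1\}\cup b^G$, that the order of $b$ is a prime, denoted $p$, and that $|N|=p^n$ for a positive integer $n$. *)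

theory Defs
  imports
    "HOL-Algebra.Algebra"
    "HOL-Library.Complex_Order"
    "Jordan_Normal_Form.VS_Connect"
begin

section \<open>Complex matrix representations and their characters\<close>

definition GL :: "nat \<Rightarrow> complex mat monoid" where
  "GL d = units_of (ring_mat TYPE(complex) d ())"

definition representation ::
    "('a, 'm) monoid_scheme \<Rightarrow> nat \<Rightarrow> ('a \<Rightarrow> complex mat) \<Rightarrow> bool" where
  "representation G d \<rho> \<longleftrightarrow> \<rho> \<in> hom G (GL d)"

definition invariant_subspace ::
    "('a, 'm) monoid_scheme \<Rightarrow> nat \<Rightarrow> ('a \<Rightarrow> complex mat) \<Rightarrow> complex vec set \<Rightarrow> bool" where
  "invariant_subspace G d \<rho> W \<longleftrightarrow>
     VectorSpace.subspace class_ring W (module_vec TYPE(complex) d) \<and>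
     (\<forall>x\<in>carrier G. \<forall>v\<in>W. \<rho> x *\<^sub>v v \<in> W)"

definition irreducible_representation ::
    "('a, 'm) monoid_scheme \<Rightarrow> nat \<Rightarrow> ('a \<Rightarrow> complex mat) \<Rightarrow> bool" where
  "irreducible_representation G d \<rho> \<longleftrightarrow>
     representation G d \<rho> \<and> d > 0 \<and>
     (\<forall>W. invariant_subspace G d \<rho> W \<longrightarrow> W = {0\<^sub>v d} \<or> W = carrier_vec d)"

definition mat_trace :: "complex mat \<Rightarrow> complex" where
  "mat_trace A = (\<Sum>i<dim_row A. A $$ (i, i))"

text \<open>
  Characters are functions on the group, so they are made \<^const>\<open>undefined\<close> outside the carrier;
  otherwise one character would be counted as many different functions.
\<close>

definition character_of ::
    "('a, 'm) monoid_scheme \<Rightarrow> ('a \<Rightarrow> complex mat) \<Rightarrow> 'a \<Rightarrow> complex" where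
  "character_of G \<rho> = (\<lambda>x\<in>carrier G. mat_trace (\<rho> x))"

definition Irr :: "('a, 'm) monoid_scheme \<Rightarrow> ('a \<Rightarrow> complex) set" where
  "Irr G = {character_of G \<rho> | d \<rho>. irreducible_representation G d \<rho>}"

definition principal_character :: "('a, 'm) monoid_scheme \<Rightarrow> 'a \<Rightarrow> complex" where
  "principal_character G = (\<lambda>x\<in>carrier G. 1)"

definition char_kernel :: "('a, 'm) monoid_scheme \<Rightarrow> ('a \<Rightarrow> complex) \<Rightarrow> 'a set" where
  "char_kernel G \<chi> = {x \<in> carrier G. \<chi> x = \<chi> \<one>\<^bsub>G\<^esub>}"

text \<open>
  Here and below, \<open>x \<le> y\<close> for complex numbers is the order of \<^theory>\<open>HOL-Library.Complex_Order\<close>: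
  it says that \<open>y - x\<close> is a nonnegative real number.
\<close>

definition Irr_enumeration ::
    "('a, 'm) monoid_scheme \<Rightarrow> nat \<Rightarrow> (nat \<Rightarrow> 'a \<Rightarrow> complex) \<Rightarrow> bool" where
  "Irr_enumeration G k \<chi> \<longleftrightarrow>
     bij_betw \<chi> {1..k} (Irr G) \<and>
     \<chi> 1 = principal_character G \<and>
     (\<forall>i j. 1 \<le> i \<and> i \<le> j \<and> j \<le> k \<longrightarrow> \<chi> i \<one>\<^bsub>G\<^esub> \<le> \<chi> j \<one>\<^bsub>G\<^esub>)"


section \<open>Conjugacy classes, centre, CD1-groups\<close>

definition conj_class :: "('a, 'm) monoid_scheme \<Rightarrow> 'a \<Rightarrow> 'a set" where
  "conj_class G x = {y \<otimes>\<^bsub>G\<^esub> x \<otimes>\<^bsub>G\<^esub> inv\<^bsub>G\<^esub> y | y. y \<in> carrier G}"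

definition center :: "('a, 'm) monoid_scheme \<Rightarrow> 'a set" where
  "center G = {z \<in> carrier G. \<forall>x\<in>carrier G. z \<otimes>\<^bsub>G\<^esub> x = x \<otimes>\<^bsub>G\<^esub> z}"

definition columns_differ_once :: "('a, 'm) monoid_scheme \<Rightarrow> 'a \<Rightarrow> 'a \<Rightarrow> bool" where
  "columns_differ_once G a b \<longleftrightarrow>
     a \<in> carrier G \<and> b \<in> carrier G \<and> conj_class G a \<noteq> conj_class G b \<and>
     (\<exists>\<chi>\<in>Irr G. \<chi> a \<noteq> \<chi> b \<and> (\<forall>\<psi>\<in>Irr G - {\<chi>}. \<psi> a = \<psi> b))"

definition CD1_group :: "('a, 'm) monoid_scheme \<Rightarrow> bool" where
  "CD1_group G \<longleftrightarrow>
     group G \<and> finite (carrier G) \<and> Coset.order G > 2 \<and> (\<exists>a b. columns_differ_once G a b)"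

end

theory Submission
  imports Defs "Jordan_Normal_Form.Spectral_Radius" "Jordan_Normal_Form.DL_Rank"
begin

text \<open>
  Let \<open>\<theta>\<close> be the only row in which the columns \<open>a\<close> and \<open>b\<close> differ. Subtracting the orthogonality
  relations of these two columns with a third column \<open>y\<close> leaves the single term
  \<open>(\<theta> a - \<theta> b) * \<theta> (inv y)\<close> (\<open>columns_differ_once_vanishing\<close>). Taking \<open>y\<close> to be the identity, where
  \<open>\<theta>\<close> is nonzero, shows that \<open>a\<close> or \<open>b\<close> is the identity; as \<open>b \<noteq> \<one>\<close>, it is \<open>a\<close>. Write \<open>d\<close> for the
  degree of \<open>\<theta>\<close>, \<open>h\<close> for the size of the class of \<open>b\<close> and \<open>g\<close> for the group order. The same relation
  gives \<open>(d - \<theta> b) * d = g\<close>. It also shows that \<open>b\<close> is conjugate to its inverse, and then that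
  \<open>\<theta> b = - d / h\<close> and that \<open>\<theta> x = 0\<close> for every \<open>x\<close> that is neither the identity nor conjugate to \<open>b\<close>
  (\<open>gap_eq\<close>, \<open>b_real\<close>, \<open>theta_b\<close>, \<open>theta_zero\<close>). Hence \<open>g = d\<^sup>2 * (1 + h) / h\<close>.

  Everything else follows from these values. As \<open>g\<close> is the sum of the squared degrees, greater than 2 and
  at most \<open>2 * d\<^sup>2\<close>, the character \<open>\<theta>\<close> is the unique one of largest degree (\<open>deg_less\<close>). An irreducible
  character has no zeros on the centre (\<open>Irr_center_nonzero\<close>), so a central element is the identity
  or conjugate, hence equal, to \<open>b\<close> (\<open>center_subset\<close>). If \<open>h \<ge> 2\<close> the element \<open>b\<close> is not central, and
  the centre is trivial; if \<open>h = 1\<close> the centre is \<open>{\<one>, b}\<close>, which is also the common kernel of the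
  characters other than \<open>\<theta>\<close> (\<open>common_kernel_subset\<close>).

  Column orthogonality is derived from Schur's lemma. Averaging elementary matrices over the group gives
  row orthogonality. For completeness of the irreducible characters among class functions, note that the
  trace of any representation is a sum of traces of irreducible ones, as one sees from block triangular
  form; a class function orthogonal to all irreducible characters can therefore be tested
  against the regular representation, whose trace is concentrated at the identity, and so it is zero
  (\<open>class_function_zero_if_orthogonal\<close>).
\<close>

section \<open>Traces and adapted bases\<close>

lemma index_mult_mat_sum:
  assumes "A \<in> carrier_mat n m" "B \<in> carrier_mat m l" "i < n" "j < l"
  shows "(A * B) $$ (i, j) = (\<Sum>k<m. A $$ (i, k) * B $$ (k, j))"
  using assms by (auto simp: scalar_prod_def lessThan_atLeast0 intro!: sum.cong)

lemma index_mult_unit_vec: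
  fixes A :: "'a :: semiring_1 mat"
  assumes "A \<in> carrier_mat n m" "i < n" "j < m"
  shows "(A *\<^sub>v unit_vec m j) $ i = A $$ (i, j)"
  using assms by auto

lemma mat_trace_carrier: "A \<in> carrier_mat d d \<Longrightarrow> mat_trace A = (\<Sum>i<d. A $$ (i, i))"
  by (auto simp: mat_trace_def)

lemma mat_trace_one: "mat_trace (1\<^sub>m d) = of_nat d"
  by (simp add: mat_trace_def)

lemma mat_trace_smult: "mat_trace (c \<cdot>\<^sub>m A) = c * mat_trace A" if "A \<in> carrier_mat d d"
  using that by (auto simp: mat_trace_def sum_distrib_left)

lemma mat_trace_mult:
  assumes "A \<in> carrier_mat n m" "B \<in> carrier_mat m n"
  shows "mat_trace (A * B) = (\<Sum>i<n. \<Sum>k<m. A $$ (i, k) * B $$ (k, i))"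
  using assms by (subst mat_trace_carrier[of _ n])
    (auto simp: index_mult_mat_sum[OF assms] simp del: index_mult_mat(1) intro!: sum.cong)

lemma mat_trace_mult_commute:
  assumes "A \<in> carrier_mat n m" "B \<in> carrier_mat m n"
  shows "mat_trace (A * B) = mat_trace (B * A)"
  unfolding mat_trace_mult[OF assms] mat_trace_mult[OF assms(2,1)]
  by (subst sum.swap) (simp add: mult.commute)

lemma class_ring_subspaceI:
  fixes W :: "complex vec set"
  assumes "W \<subseteq> carrier_vec d" "0\<^sub>v d \<in> W"
    and "\<And>v w. v \<in> W \<Longrightarrow> w \<in> W \<Longrightarrow> v + w \<in> W"
    and "\<And>c v. v \<in> W \<Longrightarrow> c \<cdot>\<^sub>v v \<in> W"
  shows "VectorSpace.subspace class_ring W (module_vec TYPE(complex) d)"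
  unfolding VectorSpace.subspace_def submodule_def
  using assms vec_vs vec_module by (auto simp: module_vec_simps class_ring_simps)

text \<open>
  A basis of \<open>W\<close> is extended to a basis of the whole space; its vectors, those of \<open>W\<close> first, are the
  columns of \<open>P\<close>. Hence \<open>W\<close> consists of the vectors whose \<open>P\<close>-coordinates vanish from position \<open>m\<close> on.
\<close>

lemma subspace_adapted_basis:
  fixes W :: "complex vec set"
  assumes "VectorSpace.subspace class_ring W (module_vec TYPE(complex) d)"
  obtains m P Q where "m \<le> d" "P \<in> carrier_mat d d" "Q \<in> carrier_mat d d"
    "P * Q = 1\<^sub>m d" "Q * P = 1\<^sub>m d"
    "W = {P *\<^sub>v v |v. v \<in> carrier_vec d \<and> (\<forall>i. m \<le> i \<and> i < d \<longrightarrow> v $ i = 0)}"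
proof -
  interpret vec_space "TYPE(complex)" d .
  have W: "W \<subseteq> carrier_vec d" and sub: "submodule class_ring W V"
    using assms by (auto simp: VectorSpace.subspace_def submodule_def module_vec_simps)
  obtain B where B: "finite B" "maximal B (\<lambda>S. S \<subseteq> W \<and> lin_indpt S)"
  proof -
    have "lin_indpt {}" using finite_lin_indpt2[of "{}"] by auto
    hence "\<exists>B. finite B \<and> maximal B (\<lambda>S. S \<subseteq> W \<and> lin_indpt S)"
      using li_le_dim[OF fin_dim] W
      by (intro maximal_exists[where P = "\<lambda>S. S \<subseteq> W \<and> lin_indpt S" and N = dim and B = "{}"]) auto
    thus ?thesis using that by blast
  qed
  hence BW: "B \<subseteq> W" and Bli: "lin_indpt B" by (auto simp: maximal_def)
  have BV: "B \<subseteq> carrier_vec d" using BW W by auto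
  have spanB: "span B = W"
  proof
    show "span B \<subseteq> W"
      using span_is_subset[OF BW sub] by simp
    show "W \<subseteq> span B"
    proof
      fix v assume v: "v \<in> W"
      show "v \<in> span B"
      proof (rule ccontr)
        assume nv: "v \<notin> span B"
        hence vB: "v \<notin> B" using BV span_mem by auto
        have "lin_indpt (B \<union> {v})"
          using lin_dep_iff_in_span[OF _ Bli _ vB] BV v W nv by auto
        hence "B \<union> {v} = B" using B(2) v BW by (auto simp: maximal_def)
        thus False using vB by auto
      qed
    qed
  qed
  obtain C where C: "finite C" "maximal C (\<lambda>S. (S \<subseteq> carrier_vec d \<and> lin_indpt S) \<and> B \<subseteq> S)"
  proof -
    have "\<exists>C. finite C \<and> maximal C (\<lambda>S. (S \<subseteq> carrier_vec d \<and> lin_indpt S) \<and> B \<subseteq> S)"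
      using li_le_dim[OF fin_dim] BV Bli
      by (intro maximal_exists[where P = "\<lambda>S. (S \<subseteq> carrier_vec d \<and> lin_indpt S) \<and> B \<subseteq> S"
            and N = dim and B = B]) auto
    thus ?thesis using that by blast
  qed
  have CV: "C \<subseteq> carrier_vec d" and Cli: "lin_indpt C" and BC: "B \<subseteq> C"
    using C(2)[unfolded maximal_def] by blast+
  have Cmax: "B' = C" if "C \<subseteq> B'" "B' \<subseteq> carrier_vec d" "lin_indpt B'" for B'
    using C(2)[unfolded maximal_def] that BC by blast
  have "maximal C (\<lambda>S. S \<subseteq> carrier_vec d \<and> lin_indpt S)"
    unfolding maximal_def using CV Cli Cmax by blast
  hence "basis C" by (rule max_li_is_basis)
  hence cardC: "card C = d" using dim_basis[OF C(1)] dim_is_n by simp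
  have CBV: "C - B \<subseteq> carrier_vec d" using CV by auto
  obtain bs where bs: "set bs = B" "distinct bs" using B(1) finite_distinct_list by blast
  obtain cs where cs: "set cs = C - B" "distinct cs"
    using C(1) finite_distinct_list[of "C - B"] by blast
  define ps where "ps = bs @ cs"
  have ps: "set ps = C" "distinct ps" using bs cs BC by (auto simp: ps_def)
  have lps: "length ps = d" using ps cardC distinct_card by metis
  define m where "m = length bs"
  have md: "m \<le> d" using lps by (simp add: m_def ps_def)
  define P where "P = mat_of_cols d ps"
  have P: "P \<in> carrier_mat d d" using lps by (auto simp: P_def)
  have colsP: "cols P = ps" using ps CV by (simp add: P_def)
  have rkP: "rank P = d" using lin_indpt_full_rank[OF P] colsP ps Cli by simp
  hence "det P \<noteq> 0" using det_rank_iff[OF P] by simp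
  from det_non_zero_imp_unit[OF P this, of "()"]
  obtain Q where Q: "Q \<in> carrier_mat d d" "P * Q = 1\<^sub>m d" "Q * P = 1\<^sub>m d"
    by (auto simp: Units_def ring_mat_def)
  have setW: "W = {P *\<^sub>v v |v. v \<in> carrier_vec d \<and> (\<forall>i. m \<le> i \<and> i < d \<longrightarrow> v $ i = 0)}" (is "_ = ?R")
  proof
    show "W \<subseteq> ?R"
    proof
      fix w assume w: "w \<in> W"
      then obtain a where a: "w = lincomb a B"
        using spanB finite_in_span[OF B(1) BV] by blast
      \<comment> \<open>\<open>lincomb\<close> over \<open>B\<close> becomes \<open>lincomb\<close> over \<open>C\<close> once the coefficients are set to 0 off \<open>B\<close>.\<close>
      define a' where "a' = (\<lambda>x. if x \<in> B then a x else 0)"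
      have "w = lincomb a' B" unfolding a a'_def
        by (rule lincomb_cong) (use BV in auto)
      also have "\<dots> = lincomb a' C"
      proof -
        have "lincomb a' (C - B) = 0\<^sub>v d"
          by (rule lincomb_zero) (use CV in \<open>auto simp: a'_def\<close>)
        thus ?thesis
          using lincomb_union[of B "C - B" a'] BV CBV B(1) C(1) BC
          by (auto simp: Un_absorb1 lincomb_closed)
      qed
      also have "\<dots> = P *\<^sub>v vec d (\<lambda>i. a' (col P i))"
        using mat_mult_eq_lincomb[OF P] colsP ps by simp
      finally have "w = P *\<^sub>v vec d (\<lambda>i. a' (col P i))" .
      moreover have "a' (col P i) = 0" if "m \<le> i" "i < d" for i
      proof -
        have "col P i = ps ! i" using that P colsP cols_nth[of i P] by auto
        also have "\<dots> \<in> set cs" using that lps by (auto simp: ps_def m_def nth_append)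
        finally show ?thesis using cs by (auto simp: a'_def)
      qed
      ultimately show "w \<in> ?R" by (auto intro!: exI[of _ "vec d (\<lambda>i. a' (col P i))"])
    qed
    show "?R \<subseteq> W"
    proof
      fix w assume "w \<in> ?R"
      then obtain v where v: "w = P *\<^sub>v v" "v \<in> carrier_vec d"
        "\<And>i. m \<le> i \<Longrightarrow> i < d \<Longrightarrow> v $ i = 0" by auto
      define a where "a = (\<lambda>x. v $ find_first x (cols P))"
      have ff: "a (ps ! i) = v $ i" if "i < d" for i
        using that lps ps(2) colsP by (simp add: a_def find_first_unique)
      have "w = lincomb a C"
        using lincomb_eq_mat_mult[OF P v(2)] colsP ps v(1) by (simp add: a_def)
      also have "\<dots> = lincomb a B"
      proof -
        have "a x = 0" if x: "x \<in> C - B" for x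
        proof -
          obtain j where "j < length cs" "x = cs ! j" using x cs by (metis in_set_conv_nth)
          hence "x = ps ! (m + j)" "m + j < d" using lps by (auto simp: ps_def m_def)
          thus ?thesis using ff v(3) by simp
        qed
        hence "lincomb a (C - B) = 0\<^sub>v d"
          by (intro lincomb_zero) (use CV in auto)
        thus ?thesis
          using lincomb_union[of B "C - B" a] BV CBV B(1) C(1) BC
          by (auto simp: Un_absorb1 lincomb_closed)
      qed
      also have "\<dots> \<in> span B" using B(1) BV by (auto simp: span_def)
      finally show "w \<in> W" using spanB by simp
    qed
  qed
  show thesis by (rule that[OF md P Q setW])
qed

section \<open>Traces of arbitrary representations\<close>

lemma representation_iff:
  assumes "group G"
  shows "representation G d \<rho> \<longleftrightarrow>
    (\<forall>x\<in>carrier G. \<rho> x \<in> carrier_mat d d) \<and>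
    (\<forall>x\<in>carrier G. \<forall>y\<in>carrier G. \<rho> (x \<otimes>\<^bsub>G\<^esub> y) = \<rho> x * \<rho> y) \<and>
    \<rho> \<one>\<^bsub>G\<^esub> = 1\<^sub>m d" (is "_ \<longleftrightarrow> ?R")
proof -
  interpret G: group G by (rule assms)
  interpret M: ring "ring_mat TYPE(complex) d ()" by (rule ring_mat)
  interpret GL: group "GL d" unfolding GL_def by (rule M.units_group)
  have oneGL: "\<one>\<^bsub>GL d\<^esub> = 1\<^sub>m d" and mulGL: "A \<otimes>\<^bsub>GL d\<^esub> B = A * B" for A B
    by (auto simp: GL_def units_of_def ring_mat_def)
  show ?thesis
  proof
    assume r: "representation G d \<rho>"
    hence hom: "\<rho> \<in> hom G (GL d)" by (simp add: representation_def)
    interpret h: group_hom G "GL d" \<rho> by standard (rule hom)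
    have "\<rho> x \<in> carrier_mat d d" if "x \<in> carrier G" for x
      using h.hom_closed[OF that] by (auto simp: GL_def units_of_def Units_def ring_mat_def)
    thus ?R using h.hom_mult h.hom_one oneGL mulGL by simp
  next
    assume R: ?R
    have "\<rho> x \<in> Units (ring_mat TYPE(complex) d ())" if x: "x \<in> carrier G" for x
    proof -
      have "\<rho> x * \<rho> (inv\<^bsub>G\<^esub> x) = 1\<^sub>m d" "\<rho> (inv\<^bsub>G\<^esub> x) * \<rho> x = 1\<^sub>m d"
        using R x G.inv_closed G.r_inv G.l_inv by metis+
      thus ?thesis using R x by (auto simp: Units_def ring_mat_def)
    qed
    thus "representation G d \<rho>"
      using R by (auto simp: representation_def hom_def GL_def units_of_def ring_mat_def)
  qed
qed

locale rep = group G for G :: "('a, 'm) monoid_scheme" (structure) +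
  fixes d :: nat and \<rho> :: "'a \<Rightarrow> complex mat"
  assumes representation: "representation G d \<rho>"
begin

lemma carrier_mat [simp, intro]: "x \<in> carrier G \<Longrightarrow> \<rho> x \<in> carrier_mat d d"
  and mult: "x \<in> carrier G \<Longrightarrow> y \<in> carrier G \<Longrightarrow> \<rho> (x \<otimes> y) = \<rho> x * \<rho> y"
  and one: "\<rho> \<one> = 1\<^sub>m d"
  using representation representation_iff[OF is_group] by auto

lemma inv_mult: "x \<in> carrier G \<Longrightarrow> \<rho> (inv x) * \<rho> x = 1\<^sub>m d" "x \<in> carrier G \<Longrightarrow> \<rho> x * \<rho> (inv x) = 1\<^sub>m d"
  by (metis mult inv_closed l_inv one, metis mult inv_closed r_inv one)

lemma trace_conj:
  assumes "x \<in> carrier G" "y \<in> carrier G"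
  shows "mat_trace (\<rho> (y \<otimes> x \<otimes> inv y)) = mat_trace (\<rho> x)"
proof -
  have "mat_trace (\<rho> (y \<otimes> x \<otimes> inv y)) = mat_trace ((\<rho> y * \<rho> x) * \<rho> (inv y))"
    using assms by (simp add: mult)
  also have "\<dots> = mat_trace (\<rho> (inv y) * (\<rho> y * \<rho> x))"
    using assms by (intro mat_trace_mult_commute[of _ d d]) (auto intro!: mult_carrier_mat[of _ _ d])
  also have "\<rho> (inv y) * (\<rho> y * \<rho> x) = (\<rho> (inv y) * \<rho> y) * \<rho> x"
    using assms by (intro assoc_mult_mat[of _ d d _ d _ d, symmetric]) auto
  also have "\<dots> = \<rho> x" using assms by (simp add: inv_mult left_mult_one_mat[of _ d d])
  finally show ?thesis .
qed

text \<open>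
  In a basis adapted to an invariant subspace \<open>W\<close> the matrices become block triangular. The two
  diagonal blocks are the representations on \<open>W\<close> and on the quotient by \<open>W\<close>, and the trace
  is the sum of the traces of these blocks.
\<close>

lemma reducible_trace:
  assumes W: "invariant_subspace G d \<rho> W" "W \<noteq> {0\<^sub>v d}" "W \<noteq> carrier_vec d"
  obtains d1 d2 \<rho>1 \<rho>2 where "d1 < d" "d2 < d" "representation G d1 \<rho>1" "representation G d2 \<rho>2"
    "\<And>x. x \<in> carrier G \<Longrightarrow> mat_trace (\<rho> x) = mat_trace (\<rho>1 x) + mat_trace (\<rho>2 x)"
proof -
  obtain m P Q where m: "m \<le> d" and P: "P \<in> carrier_mat d d" and Q: "Q \<in> carrier_mat d d"
    and PQ: "P * Q = 1\<^sub>m d" and QP: "Q * P = 1\<^sub>m d"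
    and Weq: "W = {P *\<^sub>v v |v. v \<in> carrier_vec d \<and> (\<forall>i. m \<le> i \<and> i < d \<longrightarrow> v $ i = 0)}"
    using W(1) by (elim subspace_adapted_basis[of W d, rotated])
      (simp add: invariant_subspace_def)
  have m0: "0 < m"
  proof (rule ccontr)
    assume "\<not> 0 < m"
    have W0: "W \<subseteq> {0\<^sub>v d}"
    proof
      fix w assume "w \<in> W"
      then obtain v where v: "w = P *\<^sub>v v" "v \<in> carrier_vec d" "\<forall>i. m \<le> i \<and> i < d \<longrightarrow> v $ i = 0"
        unfolding Weq by blast
      have "v = 0\<^sub>v d" using v \<open>\<not> 0 < m\<close> by (intro eq_vecI) auto
      thus "w \<in> {0\<^sub>v d}" using v(1) P by auto
    qed
    have "P *\<^sub>v 0\<^sub>v d \<in> W" unfolding Weq by (rule CollectI, rule exI[of _ "0\<^sub>v d"]) simp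
    thus False using W0 W(2) by auto
  qed
  have md: "m < d"
  proof (rule ccontr)
    assume "\<not> m < d"
    hence "v \<in> W" if "v \<in> carrier_vec d" for v
      unfolding Weq using that P Q PQ m
      by (auto intro!: exI[of _ "Q *\<^sub>v v"] simp: assoc_mult_mat_vec[symmetric, of _ d d _ d])
    moreover have "W \<subseteq> carrier_vec d" using P by (auto simp: Weq)
    ultimately show False using W(3) by auto
  qed
  define R where "R = (\<lambda>x. Q * \<rho> x * P)"
  have R [simp, intro]: "R x \<in> carrier_mat d d" if "x \<in> carrier G" for x
    using that P Q unfolding R_def by (intro mult_carrier_mat[of _ d d] carrier_mat)
  have Rmult: "R (x \<otimes> y) = R x * R y" if xy: "x \<in> carrier G" "y \<in> carrier G" for x y
  proof -
    note c = carrier_mat[OF xy(1)] carrier_mat[OF xy(2)]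
    have "R x * R y = Q * (\<rho> x * ((P * Q) * (\<rho> y * P)))"
      using c P Q by (simp add: R_def assoc_mult_mat[of _ d d _ d _ d] mult_carrier_mat[of _ d d _ d])
    also have "\<dots> = R (x \<otimes> y)"
      using c P Q xy by (simp add: PQ R_def mult left_mult_one_mat[of _ d d] assoc_mult_mat[of _ d d _ d _ d] mult_carrier_mat[of _ d d _ d])
    finally show ?thesis ..
  qed
  have Rone: "R \<one> = 1\<^sub>m d" using P Q QP by (simp add: R_def one)
  \<comment> \<open>The lower left block vanishes because the first \<open>m\<close> basis vectors span an invariant subspace.\<close>
  have R0: "R x $$ (i, j) = 0" if x: "x \<in> carrier G" and ij: "m \<le> i" "i < d" "j < m" for x i j
  proof -
    have jd: "j < d" using ij by simp
    have "P *\<^sub>v unit_vec d j \<in> W" unfolding Weq using ij by (auto intro!: exI[of _ "unit_vec d j"])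
    hence "\<rho> x *\<^sub>v (P *\<^sub>v unit_vec d j) \<in> W" using W(1) x by (auto simp: invariant_subspace_def)
    then obtain v where v: "\<rho> x *\<^sub>v (P *\<^sub>v unit_vec d j) = P *\<^sub>v v" "v \<in> carrier_vec d"
      "\<forall>i. m \<le> i \<and> i < d \<longrightarrow> v $ i = 0" unfolding Weq by blast
    have "R x *\<^sub>v unit_vec d j = Q *\<^sub>v (\<rho> x *\<^sub>v (P *\<^sub>v unit_vec d j))"
      using x P Q by (simp add: R_def assoc_mult_mat_vec[of _ d d _ d] mult_carrier_mat[of _ d d _ d])
    also have "\<dots> = (Q * P) *\<^sub>v v" using P Q v by (simp add: assoc_mult_mat_vec[of _ d d _ d])
    also have "\<dots> = v" using v QP by simp
    finally have "(R x *\<^sub>v unit_vec d j) $ i = 0" using v ij by simp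
    thus ?thesis using R[OF x] jd ij by auto
  qed
  define \<rho>1 where "\<rho>1 = (\<lambda>x. mat m m (\<lambda>(i,j). R x $$ (i, j)))"
  define \<rho>2 where "\<rho>2 = (\<lambda>x. mat (d - m) (d - m) (\<lambda>(i,j). R x $$ (i + m, j + m)))"
  have split: "(\<Sum>k<d. f k) = (\<Sum>k<m. f k) + (\<Sum>k<d-m. f (k + m))" for f :: "nat \<Rightarrow> complex"
  proof -
    have "(\<Sum>k<d. f k) = (\<Sum>k<m. f k) + (\<Sum>k\<in>{m..<d}. f k)"
      using m by (subst sum.union_disjoint[symmetric]) (auto intro!: sum.cong)
    also have "(\<Sum>k\<in>{m..<d}. f k) = (\<Sum>k<d-m. f (k + m))"
      using m by (intro sum.reindex_bij_witness[of _ "\<lambda>k. k + m" "\<lambda>k. k - m"]) auto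
    finally show ?thesis .
  qed
  have "representation G m \<rho>1"
    unfolding representation_iff[OF is_group]
  proof (intro conjI ballI)
    show "\<rho>1 x \<in> carrier_mat m m" for x by (simp add: \<rho>1_def)
    show "\<rho>1 \<one> = 1\<^sub>m m" using md by (auto simp: \<rho>1_def Rone)
    fix x y assume xy: "x \<in> carrier G" "y \<in> carrier G"
    show "\<rho>1 (x \<otimes> y) = \<rho>1 x * \<rho>1 y"
    proof (rule eq_matI)
      fix i j assume "i < dim_row (\<rho>1 x * \<rho>1 y)" "j < dim_col (\<rho>1 x * \<rho>1 y)"
      hence ij: "i < m" "j < m" by (auto simp: \<rho>1_def)
      have "\<rho>1 (x \<otimes> y) $$ (i, j) = (\<Sum>k<d. R x $$ (i, k) * R y $$ (k, j))"
        using ij md xy by (simp add: \<rho>1_def Rmult index_mult_mat_sum[OF R R] del: index_mult_mat(1))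
      also have "\<dots> = (\<Sum>k<m. \<rho>1 x $$ (i, k) * \<rho>1 y $$ (k, j))"
        unfolding split using ij R0 xy by (simp add: \<rho>1_def)
      also have "\<dots> = (\<rho>1 x * \<rho>1 y) $$ (i, j)"
        using ij by (intro index_mult_mat_sum[symmetric, of _ m]) (auto simp: \<rho>1_def)
      finally show "\<rho>1 (x \<otimes> y) $$ (i, j) = (\<rho>1 x * \<rho>1 y) $$ (i, j)" .
    qed (auto simp: \<rho>1_def)
  qed
  moreover have "representation G (d - m) \<rho>2"
    unfolding representation_iff[OF is_group]
  proof (intro conjI ballI)
    show "\<rho>2 x \<in> carrier_mat (d - m) (d - m)" for x by (simp add: \<rho>2_def)
    show "\<rho>2 \<one> = 1\<^sub>m (d - m)" using md by (auto simp: \<rho>2_def Rone)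
    fix x y assume xy: "x \<in> carrier G" "y \<in> carrier G"
    show "\<rho>2 (x \<otimes> y) = \<rho>2 x * \<rho>2 y"
    proof (rule eq_matI)
      fix i j assume "i < dim_row (\<rho>2 x * \<rho>2 y)" "j < dim_col (\<rho>2 x * \<rho>2 y)"
      hence ij: "i < d - m" "j < d - m" by (auto simp: \<rho>2_def)
      have "\<rho>2 (x \<otimes> y) $$ (i, j) = (\<Sum>k<d. R x $$ (i + m, k) * R y $$ (k, j + m))"
        using ij md xy by (simp add: \<rho>2_def Rmult index_mult_mat_sum[OF R R] del: index_mult_mat(1))
      also have "\<dots> = (\<Sum>k<d-m. \<rho>2 x $$ (i, k) * \<rho>2 y $$ (k, j))"
        unfolding split using ij R0 xy by (simp add: \<rho>2_def)
      also have "\<dots> = (\<rho>2 x * \<rho>2 y) $$ (i, j)"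
        using ij by (intro index_mult_mat_sum[symmetric, of _ "d - m"]) (auto simp: \<rho>2_def)
      finally show "\<rho>2 (x \<otimes> y) $$ (i, j) = (\<rho>2 x * \<rho>2 y) $$ (i, j)" .
    qed (auto simp: \<rho>2_def)
  qed
  moreover have "mat_trace (\<rho> x) = mat_trace (\<rho>1 x) + mat_trace (\<rho>2 x)" if x: "x \<in> carrier G" for x
  proof -
    have "mat_trace (R x) = mat_trace (P * (Q * \<rho> x))"
      unfolding R_def using P Q x by (intro mat_trace_mult_commute[of _ d d]) (auto intro!: mult_carrier_mat[of _ _ d])
    also have "P * (Q * \<rho> x) = \<rho> x"
      using P Q x by (simp add: assoc_mult_mat[symmetric, of _ d d _ d _ d] PQ left_mult_one_mat[of _ d d])
    finally have "mat_trace (\<rho> x) = (\<Sum>k<d. R x $$ (k, k))"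
      using mat_trace_carrier[OF R[OF x]] by simp
    also have "\<dots> = mat_trace (\<rho>1 x) + mat_trace (\<rho>2 x)"
      unfolding split by (simp add: mat_trace_def \<rho>1_def \<rho>2_def)
    finally show ?thesis .
  qed
  ultimately show thesis using that[of m "d - m" \<rho>1 \<rho>2] m0 md by auto
qed

end

text \<open>
  By \<open>reducible_trace\<close> and induction on the degree, every trace function is a sum of
  irreducible characters, so a linear relation satisfied by all of the latter carries over; it will be
  applied to the regular representation.
\<close>

lemma trace_sum_zero_if_irreducible:
  assumes G: "group G"
    and irr: "\<And>e \<sigma>. irreducible_representation G e \<sigma> \<Longrightarrow> (\<Sum>x\<in>carrier G. w x * mat_trace (\<sigma> x)) = 0"
    and "representation G d \<rho>"
  shows "(\<Sum>x\<in>carrier G. w x * mat_trace (\<rho> x)) = 0"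
  using assms(3)
proof (induction d arbitrary: \<rho> rule: less_induct)
  case (less d)
  interpret rep G d \<rho> by (intro rep.intro rep_axioms.intro G less.prems)
  show ?case
  proof (cases "d = 0 \<or> irreducible_representation G d \<rho>")
    case True
    thus ?thesis
    proof
      assume "d = 0"
      thus ?thesis using mat_trace_carrier[OF carrier_mat] by simp
    qed (rule irr)
  next
    case False
    then obtain W where "invariant_subspace G d \<rho> W" "W \<noteq> {0\<^sub>v d}" "W \<noteq> carrier_vec d"
      using less.prems by (auto simp: irreducible_representation_def)
    then obtain d1 d2 \<rho>1 \<rho>2 where d: "d1 < d" "d2 < d" "representation G d1 \<rho>1" "representation G d2 \<rho>2"
      "\<And>x. x \<in> carrier G \<Longrightarrow> mat_trace (\<rho> x) = mat_trace (\<rho>1 x) + mat_trace (\<rho>2 x)"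
      using reducible_trace by blast
    have "(\<Sum>x\<in>carrier G. w x * mat_trace (\<rho> x)) =
      (\<Sum>x\<in>carrier G. w x * mat_trace (\<rho>1 x)) + (\<Sum>x\<in>carrier G. w x * mat_trace (\<rho>2 x))"
      unfolding sum.distrib[symmetric] by (intro sum.cong) (auto simp: d(5) distrib_left)
    thus ?thesis using less.IH[OF d(1,3)] less.IH[OF d(2,4)] by simp
  qed
qed

section \<open>Schur's lemma\<close>

locale irrep = rep +
  assumes irreducible: "irreducible_representation G d \<rho>"
begin

lemma degree_pos: "d > 0"
  and invariant_subspaceD: "invariant_subspace G d \<rho> W \<Longrightarrow> W = {0\<^sub>v d} \<or> W = carrier_vec d"
  using irreducible by (auto simp: irreducible_representation_def)

end

lemma irrepI: "group G \<Longrightarrow> irreducible_representation G d \<rho> \<Longrightarrow> irrep G d \<rho>"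
  by (intro irrep.intro rep.intro rep_axioms.intro irrep_axioms.intro)
    (auto simp: irreducible_representation_def)

text \<open>
  Schur's lemma: the kernel and the image of an intertwiner are invariant subspaces, so for
  irreducible representations a nonzero intertwiner is bijective. Conjugating with it shows that the two
  representations have the same trace.
\<close>

locale intertwiner = \<rho>: irrep G d \<rho> + \<sigma>: irrep G e \<sigma>
  for G :: "('a, 'm) monoid_scheme" (structure) and d \<rho> e \<sigma> +
  fixes T :: "complex mat"
  assumes T: "T \<in> carrier_mat e d"
    and intertwines: "x \<in> carrier G \<Longrightarrow> \<sigma> x * T = T * \<rho> x"
begin

lemma intertwines_vec:
  assumes "x \<in> carrier G" "v \<in> carrier_vec d"
  shows "\<sigma> x *\<^sub>v (T *\<^sub>v v) = T *\<^sub>v (\<rho> x *\<^sub>v v)"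
proof -
  note c = \<rho>.carrier_mat[OF assms(1)] \<sigma>.carrier_mat[OF assms(1)]
  have "\<sigma> x *\<^sub>v (T *\<^sub>v v) = (\<sigma> x * T) *\<^sub>v v" by (rule assoc_mult_mat_vec[OF c(2) T assms(2), symmetric])
  also have "\<dots> = T *\<^sub>v (\<rho> x *\<^sub>v v)"
    unfolding intertwines[OF assms(1)] by (rule assoc_mult_mat_vec[OF T c(1) assms(2)])
  finally show ?thesis .
qed

lemma kernel_invariant: "invariant_subspace G d \<rho> {v \<in> carrier_vec d. T *\<^sub>v v = 0\<^sub>v e}"
  unfolding invariant_subspace_def
proof (intro conjI ballI class_ring_subspaceI)
  fix x v assume x: "x \<in> carrier G" and v: "v \<in> {v \<in> carrier_vec d. T *\<^sub>v v = 0\<^sub>v e}"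
  have "T *\<^sub>v (\<rho> x *\<^sub>v v) = \<sigma> x *\<^sub>v 0\<^sub>v e" using intertwines_vec[OF x, of v] v by simp
  also have "\<dots> = 0\<^sub>v e" using \<sigma>.carrier_mat[OF x] by auto
  finally show "\<rho> x *\<^sub>v v \<in> {v \<in> carrier_vec d. T *\<^sub>v v = 0\<^sub>v e}"
    using v \<rho>.carrier_mat[OF x] by auto
qed (use T in \<open>auto simp: mult_add_distrib_mat_vec[of _ e d] mult_mat_vec[of _ e d]\<close>)

lemma image_invariant: "invariant_subspace G e \<sigma> {T *\<^sub>v v |v. v \<in> carrier_vec d}"
  unfolding invariant_subspace_def
proof (intro conjI ballI class_ring_subspaceI)
  show "{T *\<^sub>v v |v. v \<in> carrier_vec d} \<subseteq> carrier_vec e" using T by auto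
  show "0\<^sub>v e \<in> {T *\<^sub>v v |v. v \<in> carrier_vec d}" using T by (auto intro!: exI[of _ "0\<^sub>v d"])
next
  fix v w assume "v \<in> {T *\<^sub>v v |v. v \<in> carrier_vec d}" "w \<in> {T *\<^sub>v v |v. v \<in> carrier_vec d}"
  then obtain v' w' where "v = T *\<^sub>v v'" "w = T *\<^sub>v w'" "v' \<in> carrier_vec d" "w' \<in> carrier_vec d" by auto
  thus "v + w \<in> {T *\<^sub>v v |v. v \<in> carrier_vec d}"
    using T by (auto simp: mult_add_distrib_mat_vec[of _ e d] intro!: exI[of _ "v' + w'"])
next
  fix c v assume "v \<in> {T *\<^sub>v v |v. v \<in> carrier_vec d}"
  then obtain v' where "v = T *\<^sub>v v'" "v' \<in> carrier_vec d" by auto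
  thus "c \<cdot>\<^sub>v v \<in> {T *\<^sub>v v |v. v \<in> carrier_vec d}"
    using T by (auto simp: mult_mat_vec[of _ e d] intro!: exI[of _ "c \<cdot>\<^sub>v v'"])
next
  fix x v assume x: "x \<in> carrier G" and "v \<in> {T *\<^sub>v v |v. v \<in> carrier_vec d}"
  then obtain v' where "v = T *\<^sub>v v'" "v' \<in> carrier_vec d" by auto
  thus "\<sigma> x *\<^sub>v v \<in> {T *\<^sub>v v |v. v \<in> carrier_vec d}"
    using intertwines_vec[OF x] \<rho>.carrier_mat[OF x] by (auto intro!: exI[of _ "\<rho> x *\<^sub>v v'"])
qed

lemma nonzero_imp_inj:
  assumes "T \<noteq> 0\<^sub>m e d" "v \<in> carrier_vec d" "T *\<^sub>v v = 0\<^sub>v e"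
  shows "v = 0\<^sub>v d"
proof -
  have False if all: "\<And>v. v \<in> carrier_vec d \<Longrightarrow> T *\<^sub>v v = 0\<^sub>v e"
  proof -
    have "T $$ (i, j) = 0" if "i < e" "j < d" for i j
    proof -
      have "T $$ (i, j) = (T *\<^sub>v unit_vec d j) $ i" using T that by auto
      thus ?thesis using all that by simp
    qed
    thus False using assms(1) T by (auto intro!: eq_matI)
  qed
  hence "{v \<in> carrier_vec d. T *\<^sub>v v = 0\<^sub>v e} \<noteq> carrier_vec d" by blast
  hence "{v \<in> carrier_vec d. T *\<^sub>v v = 0\<^sub>v e} = {0\<^sub>v d}"
    using \<rho>.invariant_subspaceD[OF kernel_invariant] by simp
  moreover have "v \<in> {v \<in> carrier_vec d. T *\<^sub>v v = 0\<^sub>v e}" using assms(2,3) by simp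
  ultimately show ?thesis by simp
qed

lemma nonzero_imp_surj:
  assumes "T \<noteq> 0\<^sub>m e d" "w \<in> carrier_vec e"
  obtains v where "v \<in> carrier_vec d" "w = T *\<^sub>v v"
proof -
  have "{T *\<^sub>v v |v. v \<in> carrier_vec d} \<noteq> {0\<^sub>v e}"
  proof
    assume 0: "{T *\<^sub>v v |v. v \<in> carrier_vec d} = {0\<^sub>v e}"
    have "T *\<^sub>v unit_vec d 0 \<in> {T *\<^sub>v v |v. v \<in> carrier_vec d}"
      by (rule CollectI, rule exI[of _ "unit_vec d 0"]) simp
    hence "T *\<^sub>v unit_vec d 0 = 0\<^sub>v e" unfolding 0 by (rule singletonD)
    hence "unit_vec d 0 = (0\<^sub>v d :: complex vec)" by (intro nonzero_imp_inj[OF assms(1)]) simp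
    hence "(unit_vec d 0 :: complex vec) $ 0 = 0\<^sub>v d $ 0" by (rule arg_cong)
    thus False using \<rho>.degree_pos by simp
  qed
  hence "{T *\<^sub>v v |v. v \<in> carrier_vec d} = carrier_vec e"
    using \<sigma>.invariant_subspaceD[OF image_invariant] by simp
  hence "w \<in> {T *\<^sub>v v |v. v \<in> carrier_vec d}" using assms(2) by simp
  thus ?thesis using that by blast
qed

text \<open>
  The columns of \<open>S\<close> are preimages of the unit vectors. This gives \<open>T * S = 1\<close>, and then injectivity
  of \<open>T\<close> gives \<open>S * T = 1\<close>.
\<close>

lemma nonzero_imp_inverse:
  assumes "T \<noteq> 0\<^sub>m e d"
  obtains S where "S \<in> carrier_mat d e" "T * S = 1\<^sub>m e" "S * T = 1\<^sub>m d"
proof -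
  have "\<exists>v. v \<in> carrier_vec d \<and> unit_vec e j = T *\<^sub>v v" for j
    using nonzero_imp_surj[OF assms, of "unit_vec e j"] by (metis unit_vec_carrier)
  hence "\<forall>j. \<exists>v. v \<in> carrier_vec d \<and> unit_vec e j = T *\<^sub>v v" by blast
  from choice[OF this] obtain s where s: "\<And>j. s j \<in> carrier_vec d" "\<And>j. unit_vec e j = T *\<^sub>v s j" by blast
  define S where "S = mat_of_cols d (map s [0..<e])"
  have S: "S \<in> carrier_mat d e" using mat_of_cols_carrier(1)[of d "map s [0..<e]"] by (simp add: S_def)
  have colS: "col S j = s j" if "j < e" for j
    using that s by (simp add: S_def)
  have TS: "T * S = 1\<^sub>m e"
  proof (rule eq_matI)
    fix i j assume ij: "i < dim_row (1\<^sub>m e :: complex mat)" "j < dim_col (1\<^sub>m e :: complex mat)"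
    have "(T * S) $$ (i, j) = (T *\<^sub>v s j) $ i" using ij T S colS by simp
    thus "(T * S) $$ (i, j) = 1\<^sub>m e $$ (i, j)" using ij by (simp add: s(2)[symmetric])
  qed (use T S in auto)
  have "S * T = 1\<^sub>m d"
  proof (rule eq_matI)
    fix i j assume ij: "i < dim_row (1\<^sub>m d :: complex mat)" "j < dim_col (1\<^sub>m d :: complex mat)"
    let ?u = "unit_vec d j :: complex vec"
    let ?v = "S *\<^sub>v (T *\<^sub>v ?u)"
    have c: "T *\<^sub>v ?u \<in> carrier_vec e" "?v \<in> carrier_vec d" using T S by auto
    have "T *\<^sub>v ?v = (T * S) *\<^sub>v (T *\<^sub>v ?u)" by (rule assoc_mult_mat_vec[OF T S c(1), symmetric])
    also have "\<dots> = T *\<^sub>v ?u" unfolding TS using c(1) by simp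
    finally have "T *\<^sub>v ?v = T *\<^sub>v ?u" .
    hence "T *\<^sub>v (?v - ?u) = 0\<^sub>v e" using c T by (simp add: mult_minus_distrib_mat_vec[of _ e d])
    hence diff: "?v - ?u = 0\<^sub>v d" using c by (intro nonzero_imp_inj[OF assms]) auto
    have "?v $ i - ?u $ i = (?v - ?u) $ i" using ij by simp
    also have "\<dots> = 0" using diff ij by simp
    finally have vu: "?v $ i = ?u $ i" by simp
    have "(S * T) $$ (i, j) = ((S * T) *\<^sub>v ?u) $ i"
      using S T ij by (intro index_mult_unit_vec[symmetric]) auto
    also have "(S * T) *\<^sub>v ?u = ?v" using S T by simp
    finally show "(S * T) $$ (i, j) = 1\<^sub>m d $$ (i, j)" using vu ij by simp
  qed (use T S in auto)
  thus thesis using that S TS by blast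
qed

lemma trace_eq:
  assumes "T \<noteq> 0\<^sub>m e d" "x \<in> carrier G"
  shows "mat_trace (\<rho> x) = mat_trace (\<sigma> x)"
proof -
  obtain S where S: "S \<in> carrier_mat d e" "T * S = 1\<^sub>m e" "S * T = 1\<^sub>m d"
    using nonzero_imp_inverse[OF assms(1)] .
  note c = \<rho>.carrier_mat[OF assms(2)] \<sigma>.carrier_mat[OF assms(2)]
  have "mat_trace (\<sigma> x) = mat_trace (\<sigma> x * (T * S))" using c by (simp add: S(2) right_mult_one_mat[of _ e e])
  also have "\<sigma> x * (T * S) = T * \<rho> x * S"
    using assoc_mult_mat[OF c(2) T S(1)] intertwines[OF assms(2)] by simp
  also have "mat_trace \<dots> = mat_trace (S * (T * \<rho> x))"
    using T c S(1) by (intro mat_trace_mult_commute[of _ e d]) auto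
  also have "S * (T * \<rho> x) = \<rho> x"
    using assoc_mult_mat[OF S(1) T c(1)] c by (simp add: S(3) left_mult_one_mat[of _ d d])
  finally show ?thesis ..
qed

end

text \<open>
  Over the complex numbers \<open>A\<close> has an eigenvalue \<open>c\<close>, and \<open>A - c\<close> is a
  self-intertwiner with nontrivial kernel, hence zero by Schur's lemma.
\<close>

lemma (in irrep) commuting_is_scalar:
  assumes A: "A \<in> carrier_mat d d" and comm: "\<And>x. x \<in> carrier G \<Longrightarrow> \<rho> x * A = A * \<rho> x"
  obtains c where "A = c \<cdot>\<^sub>m 1\<^sub>m d"
proof -
  obtain c where "eigenvalue A c"
    using spectrum_non_empty[OF A degree_pos] by (auto simp: spectrum_def)
  then obtain v where v: "v \<in> carrier_vec d" "v \<noteq> 0\<^sub>v d" "A *\<^sub>v v = c \<cdot>\<^sub>v v"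
    using A by (auto simp: eigenvalue_def eigenvector_def)
  define T where "T = A - c \<cdot>\<^sub>m 1\<^sub>m d"
  have T: "T \<in> carrier_mat d d" using A by (auto simp: T_def)
  interpret intertwiner G d \<rho> d \<rho> T
  proof
    show "T \<in> carrier_mat d d" by (rule T)
    fix x assume x: "x \<in> carrier G"
    have "\<rho> x * T = \<rho> x * A - c \<cdot>\<^sub>m \<rho> x" "T * \<rho> x = A * \<rho> x - c \<cdot>\<^sub>m \<rho> x"
      using carrier_mat[OF x] A unfolding T_def
      by (auto simp: mult_minus_distrib_mat[of _ d d _ d] minus_mult_distrib_mat[of _ d d _ _ d]
          mult_smult_distrib[of _ d d _ d] mult_smult_assoc_mat[of _ d d _ d]
          left_mult_one_mat[of _ d d] right_mult_one_mat[of _ d d])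
    thus "\<rho> x * T = T * \<rho> x" using comm[OF x] by simp
  qed
  have "T *\<^sub>v v = A *\<^sub>v v - (c \<cdot>\<^sub>m 1\<^sub>m d) *\<^sub>v v"
    unfolding T_def using A v(1) by (intro minus_mult_distrib_mat_vec) auto
  also have "(c \<cdot>\<^sub>m 1\<^sub>m d) *\<^sub>v v = c \<cdot>\<^sub>v v" using v(1) by auto
  finally have "T *\<^sub>v v = 0\<^sub>v d" using v by simp
  hence T0: "T = 0\<^sub>m d d" using nonzero_imp_inj[OF _ v(1)] v(2) by blast
  have "A = c \<cdot>\<^sub>m 1\<^sub>m d"
  proof (rule eq_matI)
    fix i j assume "i < dim_row (c \<cdot>\<^sub>m 1\<^sub>m d)" "j < dim_col (c \<cdot>\<^sub>m 1\<^sub>m d)"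
    hence ij: "i < d" "j < d" by auto
    have "T $$ (i, j) = 0" using T0 ij by simp
    thus "A $$ (i, j) = (c \<cdot>\<^sub>m 1\<^sub>m d) $$ (i, j)" using A ij by (simp add: T_def)
  qed (use A in auto)
  thus thesis by (rule that)
qed

section \<open>Row orthogonality and completeness of the irreducible characters\<close>

lemma (in group) sum_carrier_mult_left:
  assumes "y \<in> carrier G"
  shows "(\<Sum>x\<in>carrier G. f (y \<otimes> x)) = (\<Sum>x\<in>carrier G. f x)"
  using assms
  by (intro sum.reindex_bij_witness[of _ "\<lambda>x. inv y \<otimes> x" "\<lambda>x. y \<otimes> x"]) (auto simp: m_assoc[symmetric])

lemma (in group) sum_carrier_conj:
  assumes "y \<in> carrier G"
  shows "(\<Sum>x\<in>carrier G. f (y \<otimes> x \<otimes> inv y)) = (\<Sum>x\<in>carrier G. f x)"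
  using assms
  by (intro sum.reindex_bij_witness[of _ "\<lambda>x. inv y \<otimes> x \<otimes> y" "\<lambda>x. y \<otimes> x \<otimes> inv y"])
    (auto simp: m_assoc[symmetric], simp_all add: m_assoc)

text \<open>
  Averaging the elementary matrix with entry 1 at \<open>(i, j)\<close> over the group, that is, summing
  \<open>\<sigma> x * E * \<rho> (inv x)\<close> over \<open>x\<close>, produces an intertwiner. Schur's
  lemma applied to these intertwiners yields the orthogonality of matrix coefficients.
\<close>

lemma averaged_intertwiner:
  fixes G (structure)
  assumes "irrep G d \<rho>" "irrep G e \<sigma>" and ij: "i < e" "j < d"
  shows "intertwiner G d \<rho> e \<sigma> (mat e d (\<lambda>(k, l). \<Sum>x\<in>carrier G. \<sigma> x $$ (k, i) * \<rho> (inv x) $$ (j, l)))"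
    (is "intertwiner _ _ _ _ _ ?T")
proof -
  interpret \<rho>: irrep G d \<rho> by fact
  interpret \<sigma>: irrep G e \<sigma> by fact
  show ?thesis
  proof
    fix y assume y: "y \<in> carrier G"
    note c = \<sigma>.carrier_mat[OF y] \<rho>.carrier_mat[OF y]
    have T: "?T \<in> carrier_mat e d" by simp
    show "\<sigma> y * ?T = ?T * \<rho> y"
    proof (rule eq_matI)
      fix k l assume "k < dim_row (?T * \<rho> y)" "l < dim_col (?T * \<rho> y)"
      hence kl: "k < e" "l < d" using c by auto
      have "(\<sigma> y * ?T) $$ (k, l) =
          (\<Sum>m<e. \<Sum>x\<in>carrier G. \<sigma> y $$ (k, m) * (\<sigma> x $$ (m, i) * \<rho> (inv x) $$ (j, l)))"
        using kl by (simp add: index_mult_mat_sum[OF c(1) T] sum_distrib_left del: index_mult_mat(1))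
      also have "\<dots> = (\<Sum>x\<in>carrier G. \<sigma> (y \<otimes> x) $$ (k, i) * \<rho> (inv x) $$ (j, l))"
        by (subst sum.swap) (use kl ij y in \<open>auto simp: \<sigma>.mult index_mult_mat_sum[of _ e e _ e]
            sum_distrib_right mult.assoc simp del: index_mult_mat(1) intro!: sum.cong\<close>)
      \<comment> \<open>Written in terms of \<open>y \<otimes> x\<close> only, the sum can be reindexed.\<close>
      also have "\<dots> = (\<Sum>x\<in>carrier G. \<sigma> (y \<otimes> x) $$ (k, i) * \<rho> (inv (y \<otimes> x) \<otimes> y) $$ (j, l))"
        using y by (intro sum.cong) (auto simp: \<rho>.inv_mult_group \<rho>.m_assoc)
      also have "\<dots> = (\<Sum>x\<in>carrier G. \<sigma> x $$ (k, i) * \<rho> (inv x \<otimes> y) $$ (j, l))"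
        by (rule \<rho>.sum_carrier_mult_left[OF y, of "\<lambda>z. \<sigma> z $$ (k, i) * \<rho> (inv z \<otimes> y) $$ (j, l)"])
      also have "\<dots> = (\<Sum>x\<in>carrier G. \<Sum>m<d. \<sigma> x $$ (k, i) * \<rho> (inv x) $$ (j, m) * \<rho> y $$ (m, l))"
        using kl ij y by (auto simp: \<rho>.mult index_mult_mat_sum[of _ d d _ d]
            sum_distrib_left mult.assoc simp del: index_mult_mat(1) intro!: sum.cong)
      also have "\<dots> = (?T * \<rho> y) $$ (k, l)"
        using kl by (subst sum.swap) (simp add: index_mult_mat_sum[OF T c(2)] sum_distrib_right del: index_mult_mat(1))
      finally show "(\<sigma> y * ?T) $$ (k, l) = (?T * \<rho> y) $$ (k, l)" .
    qed (use c in auto)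
  qed simp
qed

lemma character_of_apply: "x \<in> carrier G \<Longrightarrow> character_of G \<rho> x = mat_trace (\<rho> x)"
  by (simp add: character_of_def)

lemma Irr_obtain:
  assumes "group G" "\<psi> \<in> Irr G"
  obtains d \<rho> where "irrep G d \<rho>" "\<psi> = character_of G \<rho>"
proof -
  from assms(2) obtain d \<rho> where "irreducible_representation G d \<rho>" "\<psi> = character_of G \<rho>"
    by (auto simp: Irr_def)
  thus thesis using that irrepI[OF assms(1)] by blast
qed

lemma character_of_in_Irr: "irrep G d \<rho> \<Longrightarrow> character_of G \<rho> \<in> Irr G"
  unfolding Irr_def using irrep.irreducible by blast

lemma character_product_sum:
  fixes G (structure)
  assumes "irrep G d \<rho>" "irrep G e \<sigma>"
  shows "(\<Sum>x\<in>carrier G. mat_trace (\<sigma> x) * mat_trace (\<rho> (inv x))) =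
    (\<Sum>i<e. \<Sum>j<d. (\<Sum>x\<in>carrier G. \<sigma> x $$ (i, i) * \<rho> (inv x) $$ (j, j)))"
proof -
  interpret \<rho>: irrep G d \<rho> by fact
  interpret \<sigma>: irrep G e \<sigma> by fact
  have "(\<Sum>x\<in>carrier G. mat_trace (\<sigma> x) * mat_trace (\<rho> (inv x))) =
      (\<Sum>x\<in>carrier G. \<Sum>i<e. \<Sum>j<d. \<sigma> x $$ (i, i) * \<rho> (inv x) $$ (j, j))"
    by (intro sum.cong refl)
      (simp add: mat_trace_carrier[OF \<rho>.carrier_mat] mat_trace_carrier[OF \<sigma>.carrier_mat] sum_product)
  also have "\<dots> = (\<Sum>i<e. \<Sum>x\<in>carrier G. \<Sum>j<d. \<sigma> x $$ (i, i) * \<rho> (inv x) $$ (j, j))"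
    by (rule sum.swap)
  also have "\<dots> = (\<Sum>i<e. \<Sum>j<d. \<Sum>x\<in>carrier G. \<sigma> x $$ (i, i) * \<rho> (inv x) $$ (j, j))"
    by (intro sum.cong refl sum.swap)
  finally show ?thesis .
qed

text \<open>
  The sum splits into matrix entries of averaged intertwiners (\<open>character_product_sum\<close>,
  \<open>averaged_intertwiner\<close>). These are zero when the characters differ, and scalar when both
  characters come from the same representation.
\<close>

lemma row_orthogonality:
  fixes G (structure)
  assumes G: "group G" and \<psi>: "\<psi> \<in> Irr G" and \<phi>: "\<phi> \<in> Irr G"
  shows "(\<Sum>x\<in>carrier G. \<psi> x * \<phi> (inv x)) = (if \<psi> = \<phi> then of_nat (Coset.order G) else 0)"
proof -
  interpret group G by fact
  obtain d \<rho> where \<rho>: "irrep G d \<rho>" "\<phi> = character_of G \<rho>" using Irr_obtain[OF G \<phi>] .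
  interpret \<rho>: irrep G d \<rho> by fact
  show ?thesis
  proof (cases "\<psi> = \<phi>")
    case False
    obtain e \<sigma> where \<sigma>: "irrep G e \<sigma>" "\<psi> = character_of G \<sigma>" using Irr_obtain[OF G \<psi>] .
    have "(\<Sum>x\<in>carrier G. \<sigma> x $$ (i, i) * \<rho> (inv x) $$ (j, j)) = 0" if ij: "i < e" "j < d" for i j
    proof -
      interpret intertwiner G d \<rho> e \<sigma> "mat e d (\<lambda>(k, l). \<Sum>x\<in>carrier G. \<sigma> x $$ (k, i) * \<rho> (inv x) $$ (j, l))"
        by (rule averaged_intertwiner[OF \<rho>(1) \<sigma>(1) ij])
      have "mat e d (\<lambda>(k, l). \<Sum>x\<in>carrier G. \<sigma> x $$ (k, i) * \<rho> (inv x) $$ (j, l)) = 0\<^sub>m e d"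
      proof (rule ccontr)
        assume "\<not> ?thesis"
        hence "\<psi> = \<phi>" unfolding \<rho>(2) \<sigma>(2) character_of_def
          by (intro restrict_ext) (rule trace_eq[symmetric])
        thus False using False by simp
      qed
      hence "mat e d (\<lambda>(k, l). \<Sum>x\<in>carrier G. \<sigma> x $$ (k, i) * \<rho> (inv x) $$ (j, l)) $$ (i, j) = 0\<^sub>m e d $$ (i, j)"
        by (rule arg_cong)
      thus ?thesis using ij by simp
    qed
    hence "(\<Sum>x\<in>carrier G. mat_trace (\<sigma> x) * mat_trace (\<rho> (inv x))) = 0"
      unfolding character_product_sum[OF \<rho>(1) \<sigma>(1)] by simp
    thus ?thesis using False by (simp add: \<rho>(2) \<sigma>(2) character_of_apply)
  next
    case True
    \<comment> \<open>The averaged intertwiner is a scalar matrix \<open>c\<close>; its trace is \<open>c * d\<close> on the one hand and the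
      order of the group times the trace of the elementary matrix on the other.\<close>
    have "(\<Sum>x\<in>carrier G. \<rho> x $$ (i, i) * \<rho> (inv x) $$ (j, j)) =
      (if i = j then of_nat (Coset.order G) / of_nat d else 0)" if ij: "i < d" "j < d" for i j
    proof -
      let ?T = "mat d d (\<lambda>(k, l). \<Sum>x\<in>carrier G. \<rho> x $$ (k, i) * \<rho> (inv x) $$ (j, l))"
      interpret intertwiner G d \<rho> d \<rho> ?T by (rule averaged_intertwiner[OF \<rho>(1) \<rho>(1) ij])
      obtain c where c: "?T = c \<cdot>\<^sub>m 1\<^sub>m d"
        using \<rho>.commuting_is_scalar[OF T intertwines] by blast
      have "mat_trace ?T = c * of_nat d"
        unfolding c by (simp add: mat_trace_smult[of _ d] mat_trace_one)
      moreover have "mat_trace ?T = (if i = j then of_nat (Coset.order G) else 0)"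
      proof -
        have "mat_trace ?T = (\<Sum>x\<in>carrier G. \<Sum>k<d. \<rho> (inv x) $$ (j, k) * \<rho> x $$ (k, i))"
          by (simp add: mat_trace_def mult.commute) (rule sum.swap)
        also have "\<dots> = (\<Sum>x\<in>carrier G. (\<rho> (inv x) * \<rho> x) $$ (j, i))"
          using ij by (intro sum.cong refl index_mult_mat_sum[symmetric, of _ d d _ d]) auto
        also have "\<dots> = (\<Sum>x\<in>carrier G. if i = j then 1 else 0)"
          using ij by (intro sum.cong refl) (simp add: \<rho>.inv_mult)
        finally show ?thesis by (simp add: Coset.order_def)
      qed
      ultimately have "c = (if i = j then of_nat (Coset.order G) / of_nat d else 0)"
        using \<rho>.degree_pos by (auto simp: field_simps)
      moreover have "?T $$ (i, j) = (if i = j then c else 0)" unfolding c using ij by simp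
      ultimately show ?thesis using ij by simp
    qed
    hence "(\<Sum>x\<in>carrier G. mat_trace (\<rho> x) * mat_trace (\<rho> (inv x))) = of_nat (Coset.order G)"
      unfolding character_product_sum[OF \<rho>(1) \<rho>(1)] using \<rho>.degree_pos by simp
    thus ?thesis using True by (simp add: \<rho>(2) character_of_apply)
  qed
qed

text \<open>
  For a class function \<open>F\<close> the matrix \<open>\<Sum>x. F x * \<rho> (inv x)\<close> commutes with the
  representation, so it is scalar; orthogonality to the character says that its trace is zero.
\<close>

lemma (in irrep) class_function_average_zero:
  assumes F: "\<And>x y. x \<in> carrier G \<Longrightarrow> y \<in> carrier G \<Longrightarrow> F (y \<otimes> x \<otimes> inv y) = F x"
    and orth: "(\<Sum>x\<in>carrier G. F x * mat_trace (\<rho> (inv x))) = 0"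
    and kl: "k < d" "l < d"
  shows "(\<Sum>x\<in>carrier G. F x * \<rho> (inv x) $$ (k, l)) = 0"
proof -
  define M where "M = mat d d (\<lambda>(k, l). \<Sum>x\<in>carrier G. F x * \<rho> (inv x) $$ (k, l))"
  have M: "M \<in> carrier_mat d d" by (simp add: M_def)
  have comm: "\<rho> y * M = M * \<rho> y" if y: "y \<in> carrier G" for y
  proof (rule eq_matI)
    note c = carrier_mat[OF y]
    fix k l assume "k < dim_row (M * \<rho> y)" "l < dim_col (M * \<rho> y)"
    hence kl: "k < d" "l < d" using c M by auto
    have "(M * \<rho> y) $$ (k, l) = (\<Sum>m<d. \<Sum>x\<in>carrier G. F x * \<rho> (inv x) $$ (k, m) * \<rho> y $$ (m, l))"
      using kl by (subst index_mult_mat_sum[OF M c]) (auto simp: M_def sum_distrib_right)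
    also have "\<dots> = (\<Sum>x\<in>carrier G. F x * \<rho> (inv x \<otimes> y) $$ (k, l))"
      by (subst sum.swap) (use kl y in \<open>auto simp: mult index_mult_mat_sum[of _ d d _ d]
            sum_distrib_left mult.assoc simp del: index_mult_mat(1) intro!: sum.cong\<close>)
    also have "\<dots> = (\<Sum>x\<in>carrier G. F (y \<otimes> x \<otimes> inv y) * \<rho> (inv (y \<otimes> x \<otimes> inv y) \<otimes> y) $$ (k, l))"
      by (rule sum_carrier_conj[OF y, of "\<lambda>z. F z * \<rho> (inv z \<otimes> y) $$ (k, l)", symmetric])
    also have "\<dots> = (\<Sum>x\<in>carrier G. F x * \<rho> (y \<otimes> inv x) $$ (k, l))"
    proof (intro sum.cong refl)
      fix x assume x: "x \<in> carrier G"
      have "inv (y \<otimes> x \<otimes> inv y) \<otimes> y = y \<otimes> inv x"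
        using x y by (simp add: inv_mult_group m_assoc)
      thus "F (y \<otimes> x \<otimes> inv y) * \<rho> (inv (y \<otimes> x \<otimes> inv y) \<otimes> y) $$ (k, l) =
          F x * \<rho> (y \<otimes> inv x) $$ (k, l)"
        using F[OF x y] by simp
    qed
    also have "\<dots> = (\<Sum>x\<in>carrier G. \<Sum>m<d. \<rho> y $$ (k, m) * (F x * \<rho> (inv x) $$ (m, l)))"
      using kl y by (auto simp: mult index_mult_mat_sum[of _ d d _ d]
            sum_distrib_left mult.left_commute simp del: index_mult_mat(1) intro!: sum.cong)
    also have "\<dots> = (\<rho> y * M) $$ (k, l)"
      using kl by (subst sum.swap, subst index_mult_mat_sum[OF c M]) (auto simp: M_def sum_distrib_left)
    finally show "(\<rho> y * M) $$ (k, l) = (M * \<rho> y) $$ (k, l)" ..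
  qed (use M carrier_mat[OF y] in auto)
  obtain c where c: "M = c \<cdot>\<^sub>m 1\<^sub>m d" using commuting_is_scalar[OF M comm] .
  have "c * of_nat d = mat_trace M"
    unfolding c by (simp add: mat_trace_smult[of _ d] mat_trace_one)
  also have "\<dots> = (\<Sum>x\<in>carrier G. \<Sum>i<d. F x * \<rho> (inv x) $$ (i, i))"
    by (simp add: mat_trace_def M_def) (rule sum.swap)
  also have "\<dots> = (\<Sum>x\<in>carrier G. F x * mat_trace (\<rho> (inv x)))"
    by (intro sum.cong refl) (simp add: mat_trace_carrier[OF carrier_mat] sum_distrib_left)
  finally have "c = 0" using orth degree_pos by simp
  moreover have "M $$ (k, l) = (\<Sum>x\<in>carrier G. F x * \<rho> (inv x) $$ (k, l))"
    using kl by (simp add: M_def)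
  ultimately show ?thesis using kl by (simp add: c)
qed

lemma (in group) regular_representation_exists:
  assumes fin: "finite (carrier G)"
  obtains \<rho> where "representation G (Coset.order G) \<rho>"
    "\<And>x. x \<in> carrier G \<Longrightarrow> mat_trace (\<rho> x) = (if x = \<one> then of_nat (Coset.order G) else 0)"
proof -
  define g where "g = Coset.order G"
  obtain e where e: "bij_betw e {..<g} (carrier G)"
    using ex_bij_betw_nat_finite[OF fin] by (auto simp: g_def Coset.order_def lessThan_atLeast0)
  have eG: "e i \<in> carrier G" if "i < g" for i using e that by (auto simp: bij_betw_def)
  have einj: "e i = e j \<longleftrightarrow> i = j" if "i < g" "j < g" for i j
    using e that by (auto simp: bij_betw_def inj_on_def)
  define \<rho> where "\<rho> = (\<lambda>x. mat g g (\<lambda>(i, j). if e i = x \<otimes> e j then 1 else (0 :: complex)))"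
  have "representation G g \<rho>"
    unfolding representation_iff[OF is_group]
  proof (intro conjI ballI)
    show "\<rho> x \<in> carrier_mat g g" for x by (simp add: \<rho>_def)
    show "\<rho> \<one> = 1\<^sub>m g" by (auto simp: \<rho>_def eG einj)
    fix x y assume xy: "x \<in> carrier G" "y \<in> carrier G"
    show "\<rho> (x \<otimes> y) = \<rho> x * \<rho> y"
    proof (rule eq_matI)
      fix i j assume "i < dim_row (\<rho> x * \<rho> y)" "j < dim_col (\<rho> x * \<rho> y)"
      hence ij: "i < g" "j < g" by (auto simp: \<rho>_def)
      have "y \<otimes> e j \<in> carrier G" using xy eG[OF ij(2)] by simp
      then obtain m where m: "m < g" "e m = y \<otimes> e j"
        using e unfolding bij_betw_def by (metis imageE lessThan_iff)
      have em: "e k = y \<otimes> e j \<longleftrightarrow> k = m" if "k < g" for k using einj[OF that m(1)] m(2) by simp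
      have "(\<rho> x * \<rho> y) $$ (i, j) = (\<Sum>k<g. \<rho> x $$ (i, k) * \<rho> y $$ (k, j))"
        using ij by (intro index_mult_mat_sum) (auto simp: \<rho>_def)
      also have "\<dots> = (\<Sum>k<g. if k = m then \<rho> x $$ (i, k) else 0)"
        using ij by (intro sum.cong refl) (simp add: \<rho>_def em)
      also have "\<dots> = \<rho> x $$ (i, m)" using m by simp
      also have "\<dots> = \<rho> (x \<otimes> y) $$ (i, j)"
        using ij m xy eG[OF ij(2)] by (simp add: \<rho>_def m_assoc)
      finally show "\<rho> (x \<otimes> y) $$ (i, j) = (\<rho> x * \<rho> y) $$ (i, j)" ..
    qed (auto simp: \<rho>_def)
  qed
  moreover have "mat_trace (\<rho> x) = (if x = \<one> then of_nat g else 0)" if x: "x \<in> carrier G" for x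
  proof -
    have "e i = x \<otimes> e i \<longleftrightarrow> x = \<one>" if "i < g" for i
      using r_cancel_one'[OF eG[OF that] x] by simp
    thus ?thesis by (simp add: mat_trace_def \<rho>_def)
  qed
  ultimately show thesis using that by (simp add: g_def)
qed

text \<open>
  Completeness of the irreducible characters. By \<open>class_function_average_zero\<close> the weights
  \<open>\<lambda>x. F (y \<otimes> inv x)\<close> annihilate the trace of every irreducible representation, hence by
  \<open>trace_sum_zero_if_irreducible\<close> also the trace of the regular representation. The latter is supported at
  the identity, where the weight is \<open>F y\<close>.
\<close>

lemma class_function_zero_if_orthogonal:
  fixes G (structure)
  assumes G: "group G" and fin: "finite (carrier G)"
    and F: "\<And>x y. x \<in> carrier G \<Longrightarrow> y \<in> carrier G \<Longrightarrow> F (y \<otimes> x \<otimes> inv y) = F x"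
    and orth: "\<And>\<psi>. \<psi> \<in> Irr G \<Longrightarrow> (\<Sum>x\<in>carrier G. F x * \<psi> (inv x)) = 0"
    and y: "y \<in> carrier G"
  shows "F y = 0"
proof -
  interpret group G by fact
  have irr: "(\<Sum>x\<in>carrier G. F (y \<otimes> inv x) * mat_trace (\<sigma> x)) = 0"
    if "irreducible_representation G e \<sigma>" for e \<sigma>
  proof -
    interpret irrep G e \<sigma> using irrepI[OF G that] .
    have 0: "(\<Sum>x\<in>carrier G. F x * mat_trace (\<sigma> (inv x))) = 0"
      using orth[OF character_of_in_Irr[OF irrep_axioms]] by (simp add: character_of_apply)
    have "(\<Sum>x\<in>carrier G. F (y \<otimes> inv x) * mat_trace (\<sigma> x)) =
        (\<Sum>x\<in>carrier G. F x * mat_trace (\<sigma> (inv x \<otimes> y)))"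
      using y by (intro sum.reindex_bij_witness[of _ "\<lambda>x. inv x \<otimes> y" "\<lambda>x. y \<otimes> inv x"])
        (auto simp: inv_mult_group m_assoc[symmetric] r_inv l_inv, simp_all add: m_assoc)
    also have "\<dots> = (\<Sum>x\<in>carrier G. \<Sum>i<e. \<Sum>j<e. F x * \<sigma> (inv x) $$ (i, j) * \<sigma> y $$ (j, i))"
      using y by (intro sum.cong refl)
        (simp add: mult mat_trace_mult[of _ e e] sum_distrib_left mult.assoc)
    also have "\<dots> = (\<Sum>i<e. \<Sum>x\<in>carrier G. \<Sum>j<e. F x * \<sigma> (inv x) $$ (i, j) * \<sigma> y $$ (j, i))"
      by (rule sum.swap)
    also have "\<dots> = (\<Sum>i<e. \<Sum>j<e. \<Sum>x\<in>carrier G. F x * \<sigma> (inv x) $$ (i, j) * \<sigma> y $$ (j, i))"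
      by (intro sum.cong refl sum.swap)
    also have "\<dots> = 0"
      by (simp add: class_function_average_zero[OF F 0] flip: sum_distrib_right)
    finally show ?thesis .
  qed
  obtain \<rho> where \<rho>: "representation G (Coset.order G) \<rho>"
    "\<And>x. x \<in> carrier G \<Longrightarrow> mat_trace (\<rho> x) = (if x = \<one> then of_nat (Coset.order G) else 0)"
    using regular_representation_exists[OF fin] by blast
  have "0 = (\<Sum>x\<in>carrier G. F (y \<otimes> inv x) * mat_trace (\<rho> x))"
    using trace_sum_zero_if_irreducible[OF G irr \<rho>(1)] by simp
  also have "\<dots> = (\<Sum>x\<in>carrier G. if x = \<one> then F y * of_nat (Coset.order G) else 0)"
    using y by (intro sum.cong refl) (simp add: \<rho>(2))
  also have "\<dots> = F y * of_nat (Coset.order G)" using fin by simp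
  finally show ?thesis using fin y by (auto simp: Coset.order_def)
qed

section \<open>Conjugacy classes and column orthogonality\<close>

context group
begin

lemma conj_class_refl: "x \<in> carrier G \<Longrightarrow> x \<in> conj_class G x"
  by (auto simp: conj_class_def intro!: exI[of _ \<one>])

lemma conj_class_subset: "x \<in> carrier G \<Longrightarrow> conj_class G x \<subseteq> carrier G"
  by (auto simp: conj_class_def)

lemma conj_class_sym:
  assumes "x \<in> carrier G" "y \<in> conj_class G x"
  shows "x \<in> conj_class G y"
proof -
  obtain z where z: "z \<in> carrier G" "y = z \<otimes> x \<otimes> inv z" using assms by (auto simp: conj_class_def)
  have "x = inv z \<otimes> y \<otimes> inv (inv z)"
    using z assms(1) by (simp add: m_assoc) (simp add: m_assoc[symmetric])
  thus ?thesis using z by (auto simp: conj_class_def intro!: exI[of _ "inv z"])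
qed

lemma conj_class_trans:
  assumes "x \<in> carrier G" "y \<in> conj_class G x" "z \<in> conj_class G y"
  shows "z \<in> conj_class G x"
proof -
  obtain u where u: "u \<in> carrier G" "y = u \<otimes> x \<otimes> inv u" using assms by (auto simp: conj_class_def)
  obtain v where v: "v \<in> carrier G" "z = v \<otimes> y \<otimes> inv v" using assms by (auto simp: conj_class_def)
  have "z = (v \<otimes> u) \<otimes> x \<otimes> inv (v \<otimes> u)"
    using u v assms(1) by (simp add: m_assoc inv_mult_group)
  thus ?thesis using u v by (auto simp: conj_class_def intro!: exI[of _ "v \<otimes> u"])
qed

lemma conj_class_eq_iff:
  assumes "x \<in> carrier G" "y \<in> carrier G"
  shows "conj_class G x = conj_class G y \<longleftrightarrow> x \<in> conj_class G y"
proof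
  assume "x \<in> conj_class G y"
  moreover from this have "y \<in> conj_class G x" using conj_class_sym assms(2) by blast
  ultimately show "conj_class G x = conj_class G y" using conj_class_trans assms by blast
qed (use conj_class_refl[OF assms(1)] in simp)

lemma conj_class_inv:
  assumes "x \<in> carrier G" "y \<in> conj_class G x"
  shows "inv y \<in> conj_class G (inv x)"
proof -
  obtain z where z: "z \<in> carrier G" "y = z \<otimes> x \<otimes> inv z" using assms by (auto simp: conj_class_def)
  have "inv y = z \<otimes> inv x \<otimes> inv z" using z assms(1) by (simp add: inv_mult_group m_assoc)
  thus ?thesis using z by (auto simp: conj_class_def)
qed

lemma conj_class_one: "conj_class G \<one> = {\<one>}"
  by (auto simp: conj_class_def intro!: exI[of _ \<one>])

lemma center_iff_conj_class:
  assumes "x \<in> carrier G"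
  shows "x \<in> center G \<longleftrightarrow> conj_class G x = {x}"
proof
  assume "x \<in> center G"
  hence "y \<otimes> x \<otimes> inv y = x" if "y \<in> carrier G" for y
    using that assms by (simp add: center_def m_assoc) (simp add: m_assoc[symmetric])
  thus "conj_class G x = {x}" using conj_class_refl[OF assms] by (auto simp: conj_class_def)
next
  assume cx: "conj_class G x = {x}"
  have "x \<otimes> y = y \<otimes> x" if y: "y \<in> carrier G" for y
  proof -
    have "y \<otimes> x \<otimes> inv y \<in> conj_class G x" using y by (auto simp: conj_class_def)
    hence "y \<otimes> x \<otimes> inv y = x" using cx by simp
    hence "x \<otimes> y = y \<otimes> x \<otimes> inv y \<otimes> y" by simp
    also have "\<dots> = y \<otimes> x" using y assms by (simp add: m_assoc)
    finally show ?thesis .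
  qed
  thus "x \<in> center G" using assms by (simp add: center_def)
qed

end

lemma Irr_class_function:
  fixes G (structure)
  assumes "group G" "\<psi> \<in> Irr G" "x \<in> carrier G" "y \<in> conj_class G x"
  shows "\<psi> y = \<psi> x"
proof -
  obtain d \<rho> where \<rho>: "irrep G d \<rho>" "\<psi> = character_of G \<rho>" using Irr_obtain[OF assms(1,2)] .
  interpret irrep G d \<rho> by fact
  obtain z where z: "z \<in> carrier G" "y = z \<otimes> x \<otimes> inv z" using assms(4) by (auto simp: conj_class_def)
  show ?thesis using z assms(3) by (simp add: \<rho>(2) character_of_apply trace_conj)
qed

lemma Irr_degree:
  assumes "group G" "\<psi> \<in> Irr G"
  obtains d where "d > 0" "\<psi> \<one>\<^bsub>G\<^esub> = of_nat d"
proof -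
  obtain d \<rho> where \<rho>: "irrep G d \<rho>" "\<psi> = character_of G \<rho>" using Irr_obtain[OF assms] .
  interpret irrep G d \<rho> by fact
  show ?thesis using that[OF degree_pos] by (simp add: \<rho>(2) character_of_apply one mat_trace_one)
qed

text \<open>
  A central element acts as a scalar by Schur's lemma, and this scalar is nonzero because the
  matrix is invertible.
\<close>

lemma Irr_center_nonzero:
  fixes G (structure)
  assumes G: "group G" and \<psi>: "\<psi> \<in> Irr G" and z: "z \<in> center G"
  shows "\<psi> z \<noteq> 0"
proof
  assume 0: "\<psi> z = 0"
  obtain d \<rho> where \<rho>: "irrep G d \<rho>" "\<psi> = character_of G \<rho>" using Irr_obtain[OF G \<psi>] .
  interpret irrep G d \<rho> by fact
  have zG: "z \<in> carrier G" using z by (simp add: center_def)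
  have "\<rho> x * \<rho> z = \<rho> z * \<rho> x" if "x \<in> carrier G" for x
    using z that by (simp add: center_def flip: mult)
  then obtain c where c: "\<rho> z = c \<cdot>\<^sub>m 1\<^sub>m d"
    using commuting_is_scalar[OF carrier_mat[OF zG]] by blast
  have "c * of_nat d = \<psi> z"
    using zG by (simp add: \<rho>(2) character_of_apply c mat_trace_smult[of _ d] mat_trace_one)
  hence "c = 0" using 0 degree_pos by simp
  hence "(\<rho> (inv z) * \<rho> z) $$ (0, 0) = 0"
    using degree_pos zG by (simp add: c index_mult_mat_sum[of _ d d _ d] del: index_mult_mat(1))
  thus False using degree_pos zG by (simp add: inv_mult)
qed

text \<open>
  Expand the indicator function of the class of \<open>y\<close> in irreducible characters: by row
  orthogonality its difference \<open>F\<close> to the expected expansion is orthogonal to all of them, so it vanishes by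
  completeness. As \<open>\<psi> (inv y)\<close> is the complex conjugate of \<open>\<psi> y\<close>, and the order divided
  by the class size is the order of the centralizer, this is the usual second orthogonality relation.
\<close>

lemma column_orthogonality:
  fixes G (structure)
  assumes G: "group G" and fin: "finite (carrier G)" and finI: "finite (Irr G)"
    and x: "x \<in> carrier G" and y: "y \<in> carrier G"
  shows "of_nat (card (conj_class G y)) * (\<Sum>\<psi>\<in>Irr G. \<psi> x * \<psi> (inv y)) =
    (if x \<in> conj_class G y then of_nat (Coset.order G) else 0)"
proof -
  interpret group G by fact
  define h where "h = (of_nat (card (conj_class G y)) :: complex)"
  define g where "g = (of_nat (Coset.order G) :: complex)"
  have g0: "g \<noteq> 0" using fin y by (auto simp: g_def Coset.order_def)
  define F where "F = (\<lambda>x. of_bool (x \<in> conj_class G y) - (\<Sum>\<psi>\<in>Irr G. h / g * \<psi> (inv y) * \<psi> x))"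
  have "F x = 0"
  proof (rule class_function_zero_if_orthogonal[OF G fin _ _ x])
    fix u v assume uv: "u \<in> carrier G" "v \<in> carrier G"
    have vu: "v \<otimes> u \<otimes> inv v \<in> conj_class G u" using uv by (auto simp: conj_class_def)
    have "v \<otimes> u \<otimes> inv v \<in> conj_class G y \<longleftrightarrow> u \<in> conj_class G y"
      using vu uv y conj_class_trans conj_class_sym conj_class_subset by blast
    moreover have "(\<Sum>\<psi>\<in>Irr G. h / g * \<psi> (inv y) * \<psi> (v \<otimes> u \<otimes> inv v)) =
        (\<Sum>\<psi>\<in>Irr G. h / g * \<psi> (inv y) * \<psi> u)"
      by (intro sum.cong refl arg_cong[where f = "\<lambda>t. _ * t"] Irr_class_function[OF G _ uv(1) vu])
    ultimately show "F (v \<otimes> u \<otimes> inv v) = F u" unfolding F_def by simp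
  next
    fix \<phi> assume \<phi>: "\<phi> \<in> Irr G"
    have "(\<Sum>u\<in>carrier G. of_bool (u \<in> conj_class G y) * \<phi> (inv u)) = (\<Sum>u\<in>conj_class G y. \<phi> (inv u))"
      using fin conj_class_subset[OF y] by (intro sum.mono_neutral_cong_right) auto
    also have "\<dots> = (\<Sum>u\<in>conj_class G y. \<phi> (inv y))"
      using y by (intro sum.cong refl Irr_class_function[OF G \<phi>] conj_class_inv) auto
    finally have 1: "(\<Sum>u\<in>carrier G. of_bool (u \<in> conj_class G y) * \<phi> (inv u)) = h * \<phi> (inv y)"
      by (simp add: h_def)
    have "(\<Sum>u\<in>carrier G. (\<Sum>\<psi>\<in>Irr G. h / g * \<psi> (inv y) * \<psi> u) * \<phi> (inv u)) =
        (\<Sum>\<psi>\<in>Irr G. h / g * \<psi> (inv y) * (\<Sum>u\<in>carrier G. \<psi> u * \<phi> (inv u)))"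
      by (simp add: sum_distrib_left sum_distrib_right mult.assoc) (rule sum.swap)
    also have "\<dots> = (\<Sum>\<psi>\<in>Irr G. if \<psi> = \<phi> then h * \<phi> (inv y) else 0)"
      using g0 by (intro sum.cong refl) (simp add: row_orthogonality[OF G _ \<phi>] g_def)
    also have "\<dots> = h * \<phi> (inv y)" using \<phi> finI by simp
    finally show "(\<Sum>u\<in>carrier G. F u * \<phi> (inv u)) = 0"
      using 1 by (simp add: F_def left_diff_distrib sum_subtractf)
  qed
  hence "of_bool (x \<in> conj_class G y) = (\<Sum>\<psi>\<in>Irr G. h / g * \<psi> (inv y) * \<psi> x)"
    by (simp add: F_def)
  also have "\<dots> = h / g * (\<Sum>\<psi>\<in>Irr G. \<psi> x * \<psi> (inv y))"
    by (simp add: sum_distrib_left mult_ac)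
  finally show ?thesis using g0 unfolding h_def[symmetric] g_def[symmetric]
    by (auto simp: field_simps)
qed

section \<open>Two columns that differ in a single row\<close>

text \<open>
  Subtract the orthogonality relations of the columns \<open>a\<close> and \<open>b\<close> with column
  \<open>y\<close>. Only the row \<open>\<theta>\<close> survives, so if \<open>\<theta> a \<noteq> \<theta> b\<close> then \<open>\<theta>\<close> vanishes outside the classes of the
  inverses of \<open>a\<close> and \<open>b\<close>. As a degree is never zero, one of these two elements is then the identity.
\<close>

lemma columns_differ_once_vanishing:
  fixes G (structure)
  assumes G: "group G" and fin: "finite (carrier G)" and finI: "finite (Irr G)"
    and a: "a \<in> carrier G" and b: "b \<in> carrier G" and y: "y \<in> carrier G"
    and \<theta>: "\<theta> \<in> Irr G" and eq: "\<And>\<psi>. \<psi> \<in> Irr G \<Longrightarrow> \<psi> \<noteq> \<theta> \<Longrightarrow> \<psi> a = \<psi> b"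
  shows "of_nat (card (conj_class G y)) * ((\<theta> a - \<theta> b) * \<theta> (inv y)) =
    of_nat (Coset.order G) * (of_bool (a \<in> conj_class G y) - of_bool (b \<in> conj_class G y))"
proof -
  have "(\<Sum>\<psi>\<in>Irr G. \<psi> a * \<psi> (inv y)) - (\<Sum>\<psi>\<in>Irr G. \<psi> b * \<psi> (inv y)) =
      (\<Sum>\<psi>\<in>Irr G. if \<psi> = \<theta> then (\<theta> a - \<theta> b) * \<theta> (inv y) else 0)"
    unfolding sum_subtractf[symmetric] by (intro sum.cong refl) (auto simp: left_diff_distrib eq)
  also have "\<dots> = (\<theta> a - \<theta> b) * \<theta> (inv y)" using \<theta> finI by simp
  finally have diff: "(\<theta> a - \<theta> b) * \<theta> (inv y) =
      (\<Sum>\<psi>\<in>Irr G. \<psi> a * \<psi> (inv y)) - (\<Sum>\<psi>\<in>Irr G. \<psi> b * \<psi> (inv y))" by (rule sym)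
  show ?thesis
    unfolding diff right_diff_distrib column_orthogonality[OF G fin finI a y]
      column_orthogonality[OF G fin finI b y] by simp
qed

text \<open>
  The situation after this reduction: the columns of \<open>\<one>\<close> and \<open>b\<close> differ exactly in the row
  \<open>\<theta>\<close>.
\<close>

locale cd1_columns = group G for G :: "('a, 'm) monoid_scheme" (structure) +
  fixes b :: 'a and \<theta> :: "'a \<Rightarrow> complex"
  assumes fin: "finite (carrier G)" and finI: "finite (Irr G)"
    and large: "Coset.order G > 2" and principal: "principal_character G \<in> Irr G"
    and b: "b \<in> carrier G" "b \<noteq> \<one>"
    and \<theta>: "\<theta> \<in> Irr G" "\<theta> \<one> \<noteq> \<theta> b"
    and others: "\<psi> \<in> Irr G \<Longrightarrow> \<psi> \<noteq> \<theta> \<Longrightarrow> \<psi> \<one> = \<psi> b"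
begin

text \<open>
  Degrees as natural numbers, so that sums of squares can be estimated in the usual linear order.
\<close>

definition char_degree :: "('a \<Rightarrow> complex) \<Rightarrow> nat" where
  "char_degree \<psi> = (THE n. \<psi> \<one> = of_nat n)"

lemma char_degree: "\<psi> \<in> Irr G \<Longrightarrow> \<psi> \<one> = of_nat (char_degree \<psi>)" "\<psi> \<in> Irr G \<Longrightarrow> char_degree \<psi> > 0"
proof -
  assume "\<psi> \<in> Irr G"
  then obtain n where n: "n > 0" "\<psi> \<one> = of_nat n" using Irr_degree[OF is_group] by blast
  hence "char_degree \<psi> = n" unfolding char_degree_def by auto
  thus "\<psi> \<one> = of_nat (char_degree \<psi>)" "char_degree \<psi> > 0" using n by auto
qed

lemma deg_principal: "char_degree (principal_character G) = 1"
  unfolding char_degree_def by (rule the_equality) (auto simp: principal_character_def)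

lemma sum_deg_squares: "(\<Sum>\<psi>\<in>Irr G. char_degree \<psi> ^ 2) = Coset.order G"
proof -
  have "of_nat (\<Sum>\<psi>\<in>Irr G. char_degree \<psi> ^ 2) = (\<Sum>\<psi>\<in>Irr G. \<psi> \<one> * \<psi> (inv \<one>))"
    by (simp add: char_degree power2_eq_square)
  also have "\<dots> = of_nat (Coset.order G)"
    using column_orthogonality[OF is_group fin finI one_closed one_closed] by (simp add: conj_class_one)
  finally show ?thesis by (simp only: of_nat_eq_iff)
qed

abbreviation h where "h \<equiv> card (conj_class G b)"

lemma h_pos: "h > 0"
  using conj_class_refl[OF b(1)] finite_subset[OF conj_class_subset[OF b(1)] fin] by (auto simp: card_gt_0_iff)

text \<open>
  The case \<open>y = \<one>\<close> of \<open>columns_differ_once_vanishing\<close>; the next lemma covers all other \<open>y\<close>.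
\<close>

lemma gap_eq: "(\<theta> \<one> - \<theta> b) * of_nat (char_degree \<theta>) = of_nat (Coset.order G)"
  using columns_differ_once_vanishing[OF is_group fin finI one_closed b(1) one_closed \<theta>(1) others] b
  by (simp add: conj_class_one char_degree \<theta>)

lemma theta_value:
  assumes "y \<in> carrier G" "y \<noteq> \<one>"
  shows "of_nat (card (conj_class G y)) * ((\<theta> \<one> - \<theta> b) * \<theta> (inv y)) =
    - of_nat (Coset.order G) * of_bool (b \<in> conj_class G y)"
proof -
  have "\<one> \<notin> conj_class G y"
    using conj_class_sym[OF assms(1), of \<one>] assms(2) by (auto simp: conj_class_one)
  thus ?thesis
    using columns_differ_once_vanishing[OF is_group fin finI one_closed b(1) assms(1) \<theta>(1) others] by simp
qed

lemma theta_zero: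
  assumes y: "y \<in> carrier G" "y \<noteq> \<one>" "inv b \<notin> conj_class G y"
  shows "\<theta> y = 0"
proof -
  have "b \<notin> conj_class G (inv y)" using conj_class_inv[of "inv y" b] y b by auto
  hence "of_nat (card (conj_class G (inv y))) * ((\<theta> \<one> - \<theta> b) * \<theta> y) = 0"
    using theta_value[of "inv y"] y by simp
  moreover have "card (conj_class G (inv y)) > 0"
    using conj_class_refl[of "inv y"] finite_subset[OF conj_class_subset[of "inv y"] fin] y
    by (auto simp: card_gt_0_iff)
  ultimately show ?thesis using \<theta>(2) by simp
qed

lemma principal_ne_theta_imp:
  assumes "principal_character G \<noteq> \<theta>"
  shows "char_degree \<theta> ^ 2 + 1 \<le> Coset.order G"
proof -
  have "(\<Sum>\<psi>\<in>{\<theta>, principal_character G}. char_degree \<psi> ^ 2) \<le> (\<Sum>\<psi>\<in>Irr G. char_degree \<psi> ^ 2)"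
    by (rule sum_mono2) (use finI \<theta> principal in auto)
  thus ?thesis using assms by (simp add: deg_principal sum_deg_squares)
qed

text \<open>
  Otherwise \<open>\<theta>\<close> would vanish at \<open>b\<close>, and then \<open>gap_eq\<close> says that the square
  of the degree of \<open>\<theta>\<close> already exhausts the group order. As the order exceeds 1, this
  leaves no room for the principal character.
\<close>

lemma b_real: "inv b \<in> conj_class G b"
proof (rule ccontr)
  assume "inv b \<notin> conj_class G b"
  hence "\<theta> b = 0" using theta_zero b by blast
  hence "of_nat (char_degree \<theta> ^ 2) = (of_nat (Coset.order G) :: complex)"
    using gap_eq char_degree(1)[OF \<theta>(1)] by (simp add: power2_eq_square)
  hence g: "char_degree \<theta> ^ 2 = Coset.order G" by (simp only: of_nat_eq_iff)
  hence "principal_character G = \<theta>" using principal_ne_theta_imp by fastforce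
  thus False using g deg_principal large by simp
qed

lemma theta_b: "of_nat h * \<theta> b = - of_nat (char_degree \<theta>)"
proof -
  have "b \<in> conj_class G (inv b)" using b_real conj_class_inv[OF b(1)] b(1) by fastforce
  moreover from this have "conj_class G (inv b) = conj_class G b"
    using conj_class_eq_iff[of b "inv b"] b(1) by simp
  ultimately have "of_nat h * ((\<theta> \<one> - \<theta> b) * \<theta> b) = - of_nat (Coset.order G)"
    using theta_value[of "inv b"] b by simp
  hence "(\<theta> \<one> - \<theta> b) * (of_nat h * \<theta> b) = (\<theta> \<one> - \<theta> b) * (- of_nat (char_degree \<theta>))"
    using gap_eq by (simp add: algebra_simps)
  thus ?thesis by (rule mult_left_cancel[THEN iffD1, rotated]) (use \<theta>(2) in simp)
qed

text \<open>
  Insert \<open>theta_b\<close>, that is, \<open>\<theta> b = - \<theta> \<one> / h\<close>, into \<open>gap_eq\<close>.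
\<close>

lemma order_eq: "Coset.order G * h = char_degree \<theta> ^ 2 * (1 + h)"
proof -
  have "of_nat (Coset.order G * h) = (of_nat h * \<theta> \<one> - of_nat h * \<theta> b) * (of_nat (char_degree \<theta>) :: complex)"
    by (simp add: gap_eq[symmetric] algebra_simps)
  also have "\<dots> = of_nat (char_degree \<theta> ^ 2 * (1 + h))"
    unfolding theta_b char_degree(1)[OF \<theta>(1)] by (simp add: algebra_simps power2_eq_square)
  finally show ?thesis by (simp only: of_nat_eq_iff)
qed

lemma order_le: "Coset.order G \<le> 2 * char_degree \<theta> ^ 2"
proof -
  have "Coset.order G * h \<le> (2 * char_degree \<theta> ^ 2) * h"
    unfolding order_eq using h_pos by (simp add: algebra_simps)
  thus ?thesis using h_pos by simp
qed

text \<open>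
  The group order is more than 2 and at most twice the square of the degree of \<open>\<theta>\<close>, so this degree
  exceeds 1. A second character of at least that degree would exhaust the sum of the squared degrees
  and leave nothing for the principal character, whose degree contributes 1.
  This identifies \<open>\<theta>\<close> with the last character of any enumeration by degree.
\<close>

lemma deg_less:
  assumes \<psi>: "\<psi> \<in> Irr G" "\<psi> \<noteq> \<theta>"
  shows "char_degree \<psi> < char_degree \<theta>"
proof (rule ccontr)
  assume n: "\<not> char_degree \<psi> < char_degree \<theta>"
  have d1: "char_degree \<theta> > 1"
  proof (rule ccontr)
    assume "\<not> char_degree \<theta> > 1"
    hence "char_degree \<theta> ^ 2 \<le> 1" using power_mono[of "char_degree \<theta>" 1 2] by simp
    thus False using order_le large by linarith
  qed
  have p: "principal_character G \<notin> {\<theta>, \<psi>}" using d1 n deg_principal by auto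
  have "(\<Sum>\<phi>\<in>{principal_character G, \<theta>, \<psi>}. char_degree \<phi> ^ 2) \<le> (\<Sum>\<phi>\<in>Irr G. char_degree \<phi> ^ 2)"
    by (rule sum_mono2) (use finI \<theta> principal \<psi> in auto)
  hence "1 + (char_degree \<theta> ^ 2 + char_degree \<psi> ^ 2) \<le> Coset.order G"
    using p \<psi>(2) by (simp add: deg_principal sum_deg_squares)
  moreover have "char_degree \<theta> ^ 2 \<le> char_degree \<psi> ^ 2" using n by (intro power_mono) auto
  ultimately show False using order_le by linarith
qed

lemma inv_b_conj: "y \<in> carrier G \<Longrightarrow> inv b \<in> conj_class G y \<longleftrightarrow> y \<in> conj_class G b"
  using b_real b(1) conj_class_sym[of b] conj_class_sym[of y] conj_class_trans[of b "inv b" y]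
    conj_class_trans[of y "inv b" b] conj_class_trans[of y b "inv b"] conj_class_sym[of b "inv b"]
  by blast

text \<open>
  \<open>\<theta>\<close> is nonzero on the centre but vanishes off \<open>\<one>\<close> and the class of \<open>b\<close>;
  and a central element of that class is equal to \<open>b\<close>.
\<close>

lemma center_subset: "center G \<subseteq> {\<one>, b}"
proof
  fix z assume z: "z \<in> center G"
  hence zG: "z \<in> carrier G" by (simp add: center_def)
  have "z = \<one> \<or> z \<in> conj_class G b"
    using theta_zero[OF zG] Irr_center_nonzero[OF is_group \<theta>(1) z] inv_b_conj[OF zG] by blast
  thus "z \<in> {\<one>, b}"
    using conj_class_sym[OF b(1), of z] center_iff_conj_class[OF zG] z by auto
qed

text \<open>
  At any other element \<open>x\<close> of the common kernel the character \<open>\<theta>\<close> vanishes, so orthogonality of the columns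
  of \<open>x\<close> and \<open>\<one>\<close> would make the squared degrees of the other characters sum to zero, although
  the principal character is among them.
\<close>

lemma common_kernel_subset:
  assumes x: "x \<in> carrier G" and k: "\<And>\<psi>. \<psi> \<in> Irr G \<Longrightarrow> \<psi> \<noteq> \<theta> \<Longrightarrow> \<psi> x = \<psi> \<one>"
  shows "x = \<one> \<or> x \<in> conj_class G b"
proof (rule ccontr)
  assume n: "\<not> ?thesis"
  hence "\<theta> x = 0" using theta_zero x inv_b_conj by blast
  have "0 = (\<Sum>\<psi>\<in>Irr G. \<psi> x * \<psi> (inv \<one>))"
    using column_orthogonality[OF is_group fin finI x one_closed] n by (simp add: conj_class_one)
  also have "\<dots> = \<theta> x * \<theta> \<one> + (\<Sum>\<psi>\<in>Irr G - {\<theta>}. \<psi> x * \<psi> \<one>)"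
    using \<theta>(1) finI by (simp add: sum.remove)
  also have "\<dots> = of_nat (\<Sum>\<psi>\<in>Irr G - {\<theta>}. char_degree \<psi> ^ 2)"
    by (simp add: \<open>\<theta> x = 0\<close> k char_degree power2_eq_square)
  finally have 0: "(\<Sum>\<psi>\<in>Irr G - {\<theta>}. char_degree \<psi> ^ 2) = 0" by (metis of_nat_0 of_nat_eq_iff)
  have "principal_character G \<in> Irr G - {\<theta>}"
    using principal deg_principal order_le large by auto
  thus False using 0 finI deg_principal by auto
qed

end

section \<open>The centre of a CD1-group\<close>

theorem lemma2p8:
  fixes G :: "('a, 'm) monoid_scheme" (structure)
    and \<chi> :: "nat \<Rightarrow> 'a \<Rightarrow> complex"
    and k p n g :: nat
    and a b :: 'a
    and a\<^sub>k b\<^sub>k :: complex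
    and N :: "'a set"
  assumes "CD1_group G"
    and "Irr_enumeration G k \<chi>"
    and "columns_differ_once G a b" and "b \<noteq> \<one>"
    and "a\<^sub>k = \<chi> k \<one>" and "b\<^sub>k = \<chi> k b" and "g = Coset.order G"
    and "N = carrier G \<inter> (\<Inter>i\<in>{1..<k}. char_kernel G (\<chi> i))"
    and "p = group.ord G b"
    and "n = (THE m. m > 0 \<and> card N = p ^ m)"
  shows "center G \<subseteq> N \<and>
    ((center G = {\<one>} \<and>
      card (conj_class G b) \<ge> 2 \<and>
      - b\<^sub>k \<le> a\<^sub>k / 2 \<and>
      of_nat g = a\<^sub>k ^ 2 *
        ((1 + of_nat (card (conj_class G b))) / of_nat (card (conj_class G b))) \<and>
      a\<^sub>k ^ 2 * ((1 + of_nat (card (conj_class G b))) / of_nat (card (conj_class G b)))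
        \<le> 3 / 2 * a\<^sub>k ^ 2)
     \<or>
     (card (center G) = 2 \<and>
      center G = {\<one>, b} \<and>
      card (conj_class G b) = 1 \<and>
      p = 2 \<and>
      n = 1 \<and>
      b\<^sub>k = - a\<^sub>k \<and>
      of_nat g = 2 * a\<^sub>k ^ 2))"
proof -
  have G: "group G" and fin: "finite (carrier G)" and large: "Coset.order G > 2"
    using assms(1) by (auto simp: CD1_group_def)
  interpret group G by (rule G)
  have enum: "bij_betw \<chi> {1..k} (Irr G)" and \<chi>1: "\<chi> 1 = principal_character G"
    and mono: "\<And>i j. 1 \<le> i \<Longrightarrow> i \<le> j \<Longrightarrow> j \<le> k \<Longrightarrow> \<chi> i \<one> \<le> \<chi> j \<one>"
    using assms(2) by (auto simp: Irr_enumeration_def)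
  have finI: "finite (Irr G)" using enum bij_betw_finite by blast
  obtain \<theta> where ab: "a \<in> carrier G" "b \<in> carrier G" and \<theta>: "\<theta> \<in> Irr G" "\<theta> a \<noteq> \<theta> b"
    and others: "\<And>\<psi>. \<psi> \<in> Irr G \<Longrightarrow> \<psi> \<noteq> \<theta> \<Longrightarrow> \<psi> a = \<psi> b"
    using assms(3) unfolding columns_differ_once_def by blast
  have k1: "k \<ge> 1" using \<theta>(1) enum by (cases "k = 0") (auto simp: bij_betw_def)
  have "\<chi> 1 \<in> Irr G" using k1 enum by (auto simp: bij_betw_def)
  hence principal: "principal_character G \<in> Irr G" unfolding \<chi>1 .
  have a1: "a = \<one>"
  proof (rule ccontr)
    assume "a \<noteq> \<one>"
    hence "(\<theta> a - \<theta> b) * \<theta> \<one> = 0"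
      using columns_differ_once_vanishing[OF G fin finI ab one_closed \<theta>(1) others] assms(4)
      by (simp add: conj_class_one)
    moreover have "\<theta> \<one> \<noteq> 0" using Irr_degree[OF G \<theta>(1)] by (metis neq0_conv of_nat_eq_0_iff)
    ultimately show False using \<theta>(2) by simp
  qed
  interpret C: cd1_columns G b \<theta>
  proof
    show "\<theta> \<one> \<noteq> \<theta> b" using \<theta>(2) a1 by simp
    show "\<psi> \<one> = \<psi> b" if "\<psi> \<in> Irr G" "\<psi> \<noteq> \<theta>" for \<psi> using others[OF that] a1 by simp
  qed (use fin finI large principal ab assms(4) \<theta>(1) in simp_all)
  have \<chi>_surj: "\<exists>i. 1 \<le> i \<and> i \<le> k \<and> \<psi> = \<chi> i" if "\<psi> \<in> Irr G" for \<psi>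
    using that bij_betw_imp_surj_on[OF enum] by fastforce
  then obtain j where j: "1 \<le> j" "j \<le> k" "\<chi> j = \<theta>" using \<theta>(1) by metis
  have \<chi>I: "\<chi> i \<in> Irr G" if "1 \<le> i" "i \<le> k" for i using that enum by (auto simp: bij_betw_def)
  have \<chi>k: "\<chi> k = \<theta>"
  proof (rule ccontr)
    assume ne: "\<chi> k \<noteq> \<theta>"
    have "\<theta> \<one> \<le> \<chi> k \<one>" using mono[OF j(1,2)] j(3) by simp
    hence "C.char_degree \<theta> \<le> C.char_degree (\<chi> k)"
      using C.char_degree(1)[OF \<theta>(1)] C.char_degree(1)[OF \<chi>I[OF k1 order_refl]] by (simp add: less_eq_complex_def)
    thus False using C.deg_less[OF \<chi>I[OF k1 order_refl] ne] by simp
  qed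
  have others_enum: "(\<exists>i\<in>{1..<k}. \<psi> = \<chi> i) \<longleftrightarrow> \<psi> \<in> Irr G \<and> \<psi> \<noteq> \<theta>" for \<psi>
  proof
    assume "\<exists>i\<in>{1..<k}. \<psi> = \<chi> i"
    then obtain i where i: "1 \<le> i" "i < k" "\<psi> = \<chi> i" by auto
    hence "\<chi> i \<noteq> \<chi> k"
      using inj_onD[OF bij_betw_imp_inj_on[OF enum], of i k] k1 by auto
    thus "\<psi> \<in> Irr G \<and> \<psi> \<noteq> \<theta>" using i \<chi>I[of i] unfolding \<chi>k by simp
  next
    assume \<psi>: "\<psi> \<in> Irr G \<and> \<psi> \<noteq> \<theta>"
    then obtain i where i: "1 \<le> i" "i \<le> k" "\<psi> = \<chi> i" using \<chi>_surj by blast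
    hence "i \<noteq> k" using \<psi> \<chi>k by blast
    thus "\<exists>i\<in>{1..<k}. \<psi> = \<chi> i" using i by (intro bexI[of _ i]) auto
  qed
  have N_iff: "x \<in> N \<longleftrightarrow> x \<in> carrier G \<and> (\<forall>\<psi>\<in>Irr G. \<psi> \<noteq> \<theta> \<longrightarrow> \<psi> x = \<psi> \<one>)" for x
  proof -
    have "x \<in> N \<longleftrightarrow> x \<in> carrier G \<and> (\<forall>\<psi>. (\<exists>i\<in>{1..<k}. \<psi> = \<chi> i) \<longrightarrow> \<psi> x = \<psi> \<one>)"
      unfolding assms(8) char_kernel_def by blast
    thus ?thesis unfolding others_enum by blast
  qed
  have bN: "{\<one>, b} \<subseteq> N" using ab C.others by (auto simp: N_iff) (metis C.others)
  have ZN: "center G \<subseteq> N" using C.center_subset bN by auto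
  have Z1: "\<one> \<in> center G" by (simp add: center_def)
  define d where "d = C.char_degree \<theta>"
  have ak: "a\<^sub>k = of_nat d" using assms(5) \<chi>k C.char_degree(1)[OF \<theta>(1)] by (simp add: d_def)
  have bk: "b\<^sub>k = - (of_nat d / of_nat C.h)"
    using C.theta_b C.h_pos \<chi>k assms(6) by (simp add: d_def field_simps)
  have "(of_nat g :: complex) * of_nat C.h = of_nat d ^ 2 * (1 + of_nat C.h)"
    using arg_cong[OF C.order_eq, of "of_nat :: nat \<Rightarrow> complex"] assms(7) by (simp add: d_def algebra_simps)
  hence g: "of_nat g = a\<^sub>k ^ 2 * ((1 + of_nat C.h) / of_nat C.h)"
    using C.h_pos by (simp add: ak field_simps)
  show ?thesis
  \<comment> \<open>The class of \<open>b\<close> has size 1 exactly when \<open>b\<close> is central; this separates the two alternatives.\<close>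
  proof (cases "C.h = 1")
    case True
    then obtain c where "conj_class G b = {c}" by (auto simp: card_1_singleton_iff)
    hence cb: "conj_class G b = {b}" using conj_class_refl[OF ab(2)] by auto
    hence Z: "center G = {\<one>, b}"
      using center_iff_conj_class[OF ab(2)] C.center_subset Z1 by auto
    have "inv b = b" using C.b_real cb by simp
    hence "b \<otimes> b = \<one>" using r_inv[OF ab(2)] by simp
    hence "b [^] (2::nat) = \<one>" using ab by (simp add: numeral_2_eq_2)
    hence "ord b dvd 2" using pow_eq_id[OF ab(2)] by simp
    hence "p = 1 \<or> p = 2" using assms(9) prime_nat_iff[of 2] two_is_prime_nat by auto
    hence p: "p = 2" using ord_eq_1[OF ab(2)] assms(4,9) by auto
    have "N = {\<one>, b}"
    proof
      show "N \<subseteq> {\<one>, b}"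
      proof
        fix x assume "x \<in> N"
        hence "x = \<one> \<or> x \<in> conj_class G b"
          unfolding N_iff by (intro C.common_kernel_subset) auto
        thus "x \<in> {\<one>, b}" using cb by simp
      qed
    qed (rule bN)
    hence "card N = 2" using assms(4) by simp
    hence "n = (THE m. m > 0 \<and> (2::nat) = 2 ^ m)" unfolding assms(10) p by simp
    also have "\<dots> = 1"
    proof (rule the_equality)
      show "m = 1" if "0 < m \<and> (2::nat) = 2 ^ m" for m
        using that power_inject_exp[of "2 :: nat" 1 m] by simp
    qed simp
    finally have "n = 1" .
    thus ?thesis using True Z ZN p g bk ak assms(4) by auto
  next
    case False
    hence h2: "C.h \<ge> 2" using C.h_pos by linarith
    have "b \<notin> center G" using center_iff_conj_class[OF ab(2)] False by auto
    hence Z: "center G = {\<one>}" using C.center_subset Z1 by auto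
    have "real d / real C.h \<le> real d / 2" using h2 by (intro divide_left_mono) auto
    hence "complex_of_real (real d / real C.h) \<le> complex_of_real (real d / 2)"
      by (simp add: less_eq_complex_def)
    hence 1: "- b\<^sub>k \<le> a\<^sub>k / 2" by (simp add: ak bk)
    have "(1 + real C.h) / real C.h \<le> 3 / 2" using h2 by (simp add: field_simps)
    hence "real d ^ 2 * ((1 + real C.h) / real C.h) \<le> 3 / 2 * real d ^ 2"
      using mult_left_mono[of "(1 + real C.h) / real C.h" "3 / 2" "real d ^ 2"] by simp
    hence "complex_of_real (real d ^ 2 * ((1 + real C.h) / real C.h)) \<le> complex_of_real (3 / 2 * real d ^ 2)"
      by (simp only: less_eq_complex_def Re_complex_of_real Im_complex_of_real)
    hence 2: "a\<^sub>k ^ 2 * ((1 + of_nat C.h) / of_nat C.h) \<le> 3 / 2 * a\<^sub>k ^ 2" by (simp add: ak)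
    show ?thesis using ZN Z h2 1 2 g by blast
  qed
qed

end
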